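(* Let $M$ be an $m$-dimensional smooth manifold. Then every vector field on $M$ admitting $m-1$ first integrals independent on an open dense subset $U\subseteq M$ is Hamiltonian with respect to pairwise commuting Poisson structures on $U$ of rank at most two.
   Context: A Poisson structure on a manifold is a bivector field $\pi$ with $[\pi,\pi]=0$, where $[\cdot,\cdot]$ is the Schouten–Nijenhuis bracket; two Poisson structures $\pi,\pi'$ commute if $[\pi,\pi']=0$. For a bivector field $\pi$, $\pi^\sharp\alpha=\mathbf{i}_\alpha\pi=\pi(\alpha,\cdot)$, and the rank of $\pi$ at $x$ is $\dim\pi^\sharp(T_x^*M)$. A vector field $X$ is Hamiltonian with respect to $\pi$ if $X=\pi^\sharp\mathrm{d}h$ for some smooth function $h$ (here on $U$, where the Poisson structures are defined). A first integral of $X$ is a function $h\in C^\infty(M)$ with $\mathrm{d}h(X)=0$. Functions are independent on $U$ if their differentials are linearly independent at every point of $U$. The manifold $M$ is not required to be orientable. *)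

theory Defs
  imports "HOL-Analysis.Analysis" "HOL-Library.Function_Algebras"
begin

section \<open>Pointwise real vector space structure on functions\<close>

instantiation "fun" :: (type, real_vector) real_vector
begin

definition scaleR_fun :: "real \<Rightarrow> ('a \<Rightarrow> 'b) \<Rightarrow> 'a \<Rightarrow> 'b" where
  "scaleR_fun r f = (\<lambda>x. r *\<^sub>R f x)"

instance
  by standard (simp_all add: scaleR_fun_def fun_eq_iff algebra_simps)

end

text \<open>Linear independence of a finite family; unlike independence of the set of its values,
  this excludes repetitions.\<close>

definition lin_indep :: "nat \<Rightarrow> (nat \<Rightarrow> 'v::real_vector) \<Rightarrow> bool" where
  "lin_indep n w \<longleftrightarrow> (\<forall>a::nat \<Rightarrow> real. (\<Sum>i<n. a i *\<^sub>R w i) = 0 \<longrightarrow> (\<forall>i<n. a i = 0))"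


section \<open>Smooth maps between Euclidean spaces\<close>

text \<open>Meaningful for open \<open>S\<close>: all iterated directional derivatives up to order \<open>k\<close> exist and
  are continuous.\<close>

primrec Ck_on :: "nat \<Rightarrow> 'e::euclidean_space set \<Rightarrow> ('e \<Rightarrow> 'f::real_normed_vector) \<Rightarrow> bool" where
  "Ck_on 0 S f \<longleftrightarrow> continuous_on S f"
| "Ck_on (Suc k) S f \<longleftrightarrow>
     (\<forall>x\<in>S. f differentiable (at x)) \<and> (\<forall>v. Ck_on k S (\<lambda>x. frechet_derivative f (at x) v))"

definition smooth_on :: "'e::euclidean_space set \<Rightarrow> ('e \<Rightarrow> 'f::real_normed_vector) \<Rightarrow> bool" where
  "smooth_on S f \<longleftrightarrow> (\<forall>k. Ck_on k S f)"


section \<open>Smooth manifolds\<close>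

text \<open>A chart is a pair of its domain and its coordinate map; values of the coordinate map outside
  the domain are irrelevant. A manifold is given by a smooth atlas that need not be maximal; its
  dimension is that of the model space \<open>'e\<close>.\<close>

type_synonym ('a, 'e) chart = "'a set \<times> ('a \<Rightarrow> 'e)"

abbreviation chart_dom :: "('a, 'e) chart \<Rightarrow> 'a set" where "chart_dom c \<equiv> fst c"

abbreviation chart_map :: "('a, 'e) chart \<Rightarrow> 'a \<Rightarrow> 'e" where "chart_map c \<equiv> snd c"

abbreviation chart_inv :: "('a, 'e) chart \<Rightarrow> 'e \<Rightarrow> 'a" where
  "chart_inv c \<equiv> inv_into (chart_dom c) (chart_map c)"

definition is_chart :: "('a::topological_space, 'e::euclidean_space) chart \<Rightarrow> bool" where
  "is_chart c \<longleftrightarrow> open (chart_dom c) \<and> open (chart_map c ` chart_dom c) \<and>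
     homeomorphism (chart_dom c) (chart_map c ` chart_dom c) (chart_map c) (chart_inv c)"

definition smooth_manifold ::
  "('a::{second_countable_topology, t2_space}, 'e::euclidean_space) chart set \<Rightarrow> bool" where
  "smooth_manifold A \<longleftrightarrow> (\<forall>c\<in>A. is_chart c) \<and>
     (\<forall>c\<in>A. \<forall>d\<in>A. smooth_on (chart_map c ` (chart_dom c \<inter> chart_dom d)) (chart_map d \<circ> chart_inv c))"

definition manifold_carrier :: "('a, 'e) chart set \<Rightarrow> 'a set" where
  "manifold_carrier A = (\<Union>c\<in>A. chart_dom c)"

definition smooth_fun ::
  "('a, 'e::euclidean_space) chart set \<Rightarrow> 'a set \<Rightarrow> ('a \<Rightarrow> real) \<Rightarrow> bool" where
  "smooth_fun A V f \<longleftrightarrow>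
     (\<forall>c\<in>A. smooth_on (chart_map c ` (chart_dom c \<inter> V)) (f \<circ> chart_inv c))"


section \<open>Tangent and cotangent spaces\<close>

text \<open>A tangent vector at \<open>p\<close> is the family of its components in the charts around \<open>p\<close>, related by
  the derivatives of the transition maps. Components in other charts are set to \<open>0\<close>, so that equal
  tangent vectors are equal as functions.\<close>

definition tangent_space ::
  "('a, 'e::euclidean_space) chart set \<Rightarrow> 'a \<Rightarrow> (('a, 'e) chart \<Rightarrow> 'e) set" where
  "tangent_space A p = {v.
     (\<forall>c\<in>A. \<forall>d\<in>A. p \<in> chart_dom c \<and> p \<in> chart_dom d \<longrightarrow>
        v d = frechet_derivative (chart_map d \<circ> chart_inv c) (at (chart_map c p)) (v c)) \<and>
     (\<forall>c. \<not> (c \<in> A \<and> p \<in> chart_dom c) \<longrightarrow> v c = 0)}"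

text \<open>Covectors are linear functionals on the tangent space, extended by \<open>0\<close> outside of it for the
  same reason.\<close>

type_synonym ('a, 'e) covector = "(('a, 'e) chart \<Rightarrow> 'e) \<Rightarrow> real"

definition cotangent_space ::
  "('a, 'e::euclidean_space) chart set \<Rightarrow> 'a \<Rightarrow> ('a, 'e) covector set" where
  "cotangent_space A p = {\<alpha>.
     (\<forall>v\<in>tangent_space A p. \<forall>w\<in>tangent_space A p. \<alpha> (v + w) = \<alpha> v + \<alpha> w) \<and>
     (\<forall>r. \<forall>v\<in>tangent_space A p. \<alpha> (r *\<^sub>R v) = r * \<alpha> v) \<and>
     (\<forall>v. v \<notin> tangent_space A p \<longrightarrow> \<alpha> v = 0)}"

text \<open>The value of the differential does not depend on the chosen chart around \<open>p\<close>; the function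
  only has to be defined near \<open>p\<close>.\<close>

definition differential ::
  "('a, 'e::euclidean_space) chart set \<Rightarrow> ('a \<Rightarrow> real) \<Rightarrow> 'a \<Rightarrow> ('a, 'e) covector" where
  "differential A f p = (\<lambda>v. if v \<in> tangent_space A p
     then let c = (SOME c. c \<in> A \<and> p \<in> chart_dom c)
          in frechet_derivative (f \<circ> chart_inv c) (at (chart_map c p)) (v c)
     else 0)"

definition smooth_vector_field ::
  "('a, 'e::euclidean_space) chart set \<Rightarrow> 'a set \<Rightarrow> ('a \<Rightarrow> ('a, 'e) chart \<Rightarrow> 'e) \<Rightarrow> bool" where
  "smooth_vector_field A V X \<longleftrightarrow> (\<forall>p\<in>V. X p \<in> tangent_space A p) \<and>
     (\<forall>c\<in>A. smooth_on (chart_map c ` (chart_dom c \<inter> V)) ((\<lambda>p. X p c) \<circ> chart_inv c))"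

definition first_integral ::
  "('a, 'e::euclidean_space) chart set \<Rightarrow> ('a \<Rightarrow> ('a, 'e) chart \<Rightarrow> 'e) \<Rightarrow> ('a \<Rightarrow> real) \<Rightarrow> bool" where
  "first_integral A X h \<longleftrightarrow> smooth_fun A (manifold_carrier A) h \<and>
     (\<forall>p\<in>manifold_carrier A. differential A h p (X p) = 0)"

definition independent_functions ::
  "('a, 'e::euclidean_space) chart set \<Rightarrow> 'a set \<Rightarrow> nat \<Rightarrow> (nat \<Rightarrow> 'a \<Rightarrow> real) \<Rightarrow> bool" where
  "independent_functions A U n F \<longleftrightarrow> (\<forall>p\<in>U. lin_indep n (\<lambda>i. differential A (F i) p))"


section \<open>Bivector fields and Poisson structures\<close>

text \<open>A bivector at \<open>p\<close>, i.e. an element of the second exterior power of the tangent space, is an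
  alternating bilinear form on the cotangent space (extended by \<open>0\<close>).\<close>

type_synonym ('a, 'e) bivector = "('a, 'e) covector \<Rightarrow> ('a, 'e) covector \<Rightarrow> real"

definition bivector_space ::
  "('a, 'e::euclidean_space) chart set \<Rightarrow> 'a \<Rightarrow> ('a, 'e) bivector set" where
  "bivector_space A p = {b.
     (\<forall>\<alpha>\<in>cotangent_space A p. b \<alpha> \<alpha> = 0) \<and>
     (\<forall>\<alpha>\<in>cotangent_space A p. \<forall>\<beta>\<in>cotangent_space A p. \<forall>\<gamma>\<in>cotangent_space A p. \<forall>r.
        b (\<alpha> + \<beta>) \<gamma> = b \<alpha> \<gamma> + b \<beta> \<gamma> \<and> b (r *\<^sub>R \<alpha>) \<gamma> = r * b \<alpha> \<gamma> \<and>
        b \<gamma> (\<alpha> + \<beta>) = b \<gamma> \<alpha> + b \<gamma> \<beta> \<and> b \<gamma> (r *\<^sub>R \<alpha>) = r * b \<gamma> \<alpha>) \<and>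
     (\<forall>\<alpha> \<beta>. \<not> (\<alpha> \<in> cotangent_space A p \<and> \<beta> \<in> cotangent_space A p) \<longrightarrow> b \<alpha> \<beta> = 0)}"

text \<open>\<open>\<lambda>q. chart_map c q \<bullet> i\<close> is the \<open>i\<close>-th coordinate function of \<open>c\<close>, so smoothness is smoothness of
  all components in all charts.\<close>

definition smooth_bivector_field ::
  "('a, 'e::euclidean_space) chart set \<Rightarrow> 'a set \<Rightarrow> ('a \<Rightarrow> ('a, 'e) bivector) \<Rightarrow> bool" where
  "smooth_bivector_field A V \<pi> \<longleftrightarrow> (\<forall>p\<in>V. \<pi> p \<in> bivector_space A p) \<and>
     (\<forall>c\<in>A. \<forall>i\<in>Basis. \<forall>j\<in>Basis.
        smooth_on (chart_map c ` (chart_dom c \<inter> V))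
          ((\<lambda>p. \<pi> p (differential A (\<lambda>q. chart_map c q \<bullet> i) p)
                    (differential A (\<lambda>q. chart_map c q \<bullet> j) p)) \<circ> chart_inv c))"

text \<open>Using \<open>T = T**\<close>: the contraction of \<open>\<pi>\<close> with \<open>\<alpha>\<close> in the first slot is the tangent
  vector \<open>\<pi>(\<alpha>, \<cdot>)\<close>.\<close>

definition sharp ::
  "('a, 'e::euclidean_space) chart set \<Rightarrow> 'a \<Rightarrow> ('a, 'e) bivector \<Rightarrow> ('a, 'e) covector
     \<Rightarrow> ('a, 'e) chart \<Rightarrow> 'e" where
  "sharp A p b \<alpha> = (THE v. v \<in> tangent_space A p \<and> (\<forall>\<beta>\<in>cotangent_space A p. \<beta> v = b \<alpha> \<beta>))"

definition bivector_rank ::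
  "('a, 'e::euclidean_space) chart set \<Rightarrow> 'a \<Rightarrow> ('a, 'e) bivector \<Rightarrow> nat" where
  "bivector_rank A p b = dim (sharp A p b ` cotangent_space A p)"

definition bivector_apply ::
  "('a, 'e::euclidean_space) chart set \<Rightarrow> ('a \<Rightarrow> ('a, 'e) bivector)
     \<Rightarrow> ('a \<Rightarrow> real) \<Rightarrow> ('a \<Rightarrow> real) \<Rightarrow> 'a \<Rightarrow> real" where
  "bivector_apply A \<pi> f g p = \<pi> p (differential A f p) (differential A g p)"

text \<open>The Schouten-Nijenhuis bracket \<open>[P, Q]\<close> of two bivector fields, as a triderivation: the
  general formula for skew-symmetric multiderivations of degrees \<open>p\<close> and \<open>q\<close>, namely
  \<open>\<Sum>\<sigma>. sgn \<sigma> * P[Q[f\<^sub>\<sigma>\<^sub>1,\<dots>,f\<^sub>\<sigma>\<^sub>q],\<dots>] - (-1)^((p-1)*(q-1)) * \<Sum>\<sigma>. sgn \<sigma> * Q[P[f\<^sub>\<sigma>\<^sub>1,\<dots>,f\<^sub>\<sigma>\<^sub>p],\<dots>]\<close> with sums over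
  \<open>(q, p-1)\<close>- and \<open>(p, q-1)\<close>-shuffles, written out for \<open>p = q = 2\<close>. Other sign conventions in use
  change the bracket at most by an overall sign.\<close>

definition schouten ::
  "('a, 'e::euclidean_space) chart set \<Rightarrow> ('a \<Rightarrow> ('a, 'e) bivector) \<Rightarrow> ('a \<Rightarrow> ('a, 'e) bivector)
     \<Rightarrow> ('a \<Rightarrow> real) \<Rightarrow> ('a \<Rightarrow> real) \<Rightarrow> ('a \<Rightarrow> real) \<Rightarrow> 'a \<Rightarrow> real" where
  "schouten A P Q f g h p =
     bivector_apply A P (bivector_apply A Q f g) h p
   - bivector_apply A P (bivector_apply A Q f h) g p
   + bivector_apply A P (bivector_apply A Q g h) f p
   + bivector_apply A Q (bivector_apply A P f g) h p
   - bivector_apply A Q (bivector_apply A P f h) g p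
   + bivector_apply A Q (bivector_apply A P g h) f p"

text \<open>\<open>[P, Q] = 0\<close> on \<open>U\<close>. A trivector field is zero iff it vanishes on all (local) functions.\<close>

definition commuting ::
  "('a::topological_space, 'e::euclidean_space) chart set \<Rightarrow> 'a set
     \<Rightarrow> ('a \<Rightarrow> ('a, 'e) bivector) \<Rightarrow> ('a \<Rightarrow> ('a, 'e) bivector) \<Rightarrow> bool" where
  "commuting A U P Q \<longleftrightarrow>
     (\<forall>V f g h. open V \<and> V \<subseteq> U \<and> smooth_fun A V f \<and> smooth_fun A V g \<and> smooth_fun A V h \<longrightarrow>
        (\<forall>p\<in>V. schouten A P Q f g h p = 0))"

definition poisson_structure ::
  "('a::topological_space, 'e::euclidean_space) chart set \<Rightarrow> 'a set
     \<Rightarrow> ('a \<Rightarrow> ('a, 'e) bivector) \<Rightarrow> bool" where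
  "poisson_structure A U \<pi> \<longleftrightarrow> smooth_bivector_field A U \<pi> \<and> commuting A U \<pi> \<pi>"

definition hamiltonian ::
  "('a, 'e::euclidean_space) chart set \<Rightarrow> 'a set \<Rightarrow> ('a \<Rightarrow> ('a, 'e) bivector)
     \<Rightarrow> ('a \<Rightarrow> ('a, 'e) chart \<Rightarrow> 'e) \<Rightarrow> bool" where
  "hamiltonian A U \<pi> X \<longleftrightarrow>
     (\<exists>h. smooth_fun A U h \<and> (\<forall>p\<in>U. X p = sharp A p (\<pi> p) (differential A h p)))"

end

theory Submission
  imports Defs
begin

text \<open>At a point of \<open>U\<close> the common kernel of \<open>dF\<^sub>0, \<dots>, dF\<^sub>m\<^sub>-\<^sub>2\<close> is a line containing \<open>X\<close>. Choose \<open>Z\<^sub>i\<close> with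
  \<open>dF\<^sub>j(Z\<^sub>i) = \<delta>\<^sub>i\<^sub>j\<close> and put \<open>\<pi>\<^sub>i = Z\<^sub>i \<and> X\<close>. Since \<open>Z\<^sub>i\<close> is unique up to that kernel, \<open>\<pi>\<^sub>i\<close> does not depend on
  the choice; hence it is globally defined without a partition of unity, and a Gram-Schmidt frame in
  a chart shows that it is smooth. The sharp map of \<open>\<pi>\<^sub>i\<close> sends \<open>dF\<^sub>i\<close> to \<open>X\<close>. Finally \<open>[Z\<^sub>i, X]\<close>
  annihilates all \<open>F\<^sub>j\<close>, so it is a multiple of \<open>X\<close> wherever \<open>X \<noteq> 0\<close>, and this kills every term of
  \<open>[Z\<^sub>i \<and> X, Z\<^sub>j \<and> X]\<close>.\<close>

section \<open>Calculus of smooth maps\<close>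

text \<open>Openness turns agreement on \<open>S\<close> into agreement near each point, so the
  derivatives agree as well and induction applies. It transfers smoothness from explicit formulas to
  functions that match them only on a chart image.\<close>

lemma Ck_on_cong:
  assumes "open S" "\<And>x. x \<in> S \<Longrightarrow> f x = g x" "Ck_on k S f"
  shows "Ck_on k S g"
  using assms(2,3)
proof (induction k arbitrary: f g)
  case 0
  then show ?case by (simp cong: continuous_on_cong)
next
  case (Suc k)
  have diff: "g differentiable (at x)" if xS: "x \<in> S" for x
  proof -
    obtain D where "(f has_derivative D) (at x)"
      using xS Suc.prems(2) by (auto simp: differentiable_def)
    then have "(g has_derivative D) (at x)"
      by (rule has_derivative_transform_within_open[OF _ \<open>open S\<close> xS]) (rule Suc.prems(1))
    then show ?thesis by (auto simp: differentiable_def)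
  qed
  have eq: "frechet_derivative f (at x) = frechet_derivative g (at x)" if "x \<in> S" for x
    using that Suc.prems \<open>open S\<close> by (intro frechet_derivative_transform_within_open) auto
  have "Ck_on k S (\<lambda>x. frechet_derivative g (at x) v)" for v
    by (rule Suc.IH[of "\<lambda>x. frechet_derivative f (at x) v"]) (use Suc.prems eq in auto)
  then show ?case using diff by simp
qed

text \<open>An introduction rule for derivatives given by a formula. The closure proofs below name
  the derivative by a product or quotient rule instead of computing
  \<open>frechet_derivative\<close>.\<close>

lemma Ck_on_SucI:
  assumes "open S" "\<And>x. x \<in> S \<Longrightarrow> (f has_derivative f' x) (at x)"
    and "\<And>v. Ck_on k S (\<lambda>x. f' x v)"
  shows "Ck_on (Suc k) S f"
proof -
  have "Ck_on k S (\<lambda>x. frechet_derivative f (at x) v)" for v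
    by (rule Ck_on_cong[OF \<open>open S\<close> _ assms(3)[of v]])
       (metis assms(2) frechet_derivative_at)
  then show ?thesis
    using assms(2) differentiableI by (metis Ck_on.simps(2))
qed

lemma Ck_on_has_derivative:
  assumes "Ck_on (Suc k) S f" "x \<in> S"
  shows "(f has_derivative frechet_derivative f (at x)) (at x)"
  using assms frechet_derivative_works by auto

lemma Ck_on_continuous_on: "Ck_on k S f \<Longrightarrow> continuous_on S f"
  by (cases k)
     (auto intro!: continuous_at_imp_continuous_on differentiable_imp_continuous_within)

text \<open>\<open>Ck_on\<close> asks for continuity only of the derivatives of top order; at lower
  order it follows from differentiability.\<close>

lemma Ck_on_Suc_imp: "Ck_on (Suc k) S f \<Longrightarrow> Ck_on k S f"
proof (induction k arbitrary: f)
  case 0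
  then show ?case using Ck_on_continuous_on[of "Suc 0" S f] by simp
next
  case (Suc k)
  then show ?case by simp
qed

lemma Ck_on_subset: "Ck_on k S f \<Longrightarrow> T \<subseteq> S \<Longrightarrow> Ck_on k T f"
  by (induction k arbitrary: f) (auto intro: continuous_on_subset)

lemma Ck_on_const: "Ck_on k S (\<lambda>x. a)"
  by (induction k arbitrary: a) simp_all

lemma Ck_on_add:
  "open S \<Longrightarrow> Ck_on k S f \<Longrightarrow> Ck_on k S g \<Longrightarrow> Ck_on k S (\<lambda>x. f x + g x)"
proof (induction k arbitrary: f g)
  case 0
  then show ?case by (simp add: continuous_on_add)
next
  case (Suc k)
  have "Ck_on k S (\<lambda>x. frechet_derivative f (at x) v + frechet_derivative g (at x) v)" for v
    using Suc by simp
  then show ?case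
    using Ck_on_has_derivative[OF Suc.prems(2)] Ck_on_has_derivative[OF Suc.prems(3)]
    by (intro Ck_on_SucI[OF \<open>open S\<close>, where f' =
          "\<lambda>x v. frechet_derivative f (at x) v + frechet_derivative g (at x) v"]
        has_derivative_add)
qed

text \<open>Leibniz rule: the derivative is a sum of two products, each pairing one original factor
  with one derivative, so both factors are also needed at order \<open>k\<close>. Products, scalar
  multiples and inner products are all instances.\<close>

lemma Ck_on_bilinear:
  assumes "bounded_bilinear pr" "open S"
  shows "Ck_on k S f \<Longrightarrow> Ck_on k S g \<Longrightarrow> Ck_on k S (\<lambda>x. pr (f x) (g x))"
proof (induction k arbitrary: f g)
  case 0
  then show ?case using assms by (simp add: bounded_bilinear.continuous_on)
next
  case (Suc k)
  have "Ck_on k S (\<lambda>x. pr (f x) (frechet_derivative g (at x) v)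
      + pr (frechet_derivative f (at x) v) (g x))" for v
    using Suc.prems Ck_on_Suc_imp[OF Suc.prems(1)] Ck_on_Suc_imp[OF Suc.prems(2)]
    by (intro Ck_on_add \<open>open S\<close> Suc.IH) auto
  then show ?case
    using Ck_on_has_derivative[OF Suc.prems(1)] Ck_on_has_derivative[OF Suc.prems(2)]
    by (intro Ck_on_SucI[OF \<open>open S\<close>, where f' = "\<lambda>x v. pr (f x) (frechet_derivative g (at x) v)
      + pr (frechet_derivative f (at x) v) (g x)"] bounded_bilinear.FDERIV[OF assms(1)])
qed

text \<open>The derivative of 1/f is -f'/f^2, a product of f' with two copies of 1/f, and 1/f is
  already of order \<open>k\<close> by induction.\<close>

lemma Ck_on_inverse:
  fixes f :: "'e::euclidean_space \<Rightarrow> real"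
  assumes "open S" "\<And>x. x \<in> S \<Longrightarrow> f x \<noteq> 0"
  shows "Ck_on k S f \<Longrightarrow> Ck_on k S (\<lambda>x. inverse (f x))"
proof (induction k)
  case 0
  then show ?case using assms by (simp add: continuous_on_inverse)
next
  case (Suc k)
  note mult = Ck_on_bilinear[OF bounded_bilinear_mult \<open>open S\<close>]
  have inv: "Ck_on k S (\<lambda>x. inverse (f x))"
    using Suc Ck_on_Suc_imp[of k S] by blast
  have "Ck_on k S (\<lambda>x. (- 1) * (inverse (f x) * frechet_derivative f (at x) v * inverse (f x)))" for v
    using Suc.prems inv by (intro mult Ck_on_const) auto
  then show ?case
    using Deriv.has_derivative_inverse[OF assms(2) Ck_on_has_derivative[OF Suc.prems]]
    by (intro Ck_on_SucI[OF \<open>open S\<close>, where f' =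
          "\<lambda>x v. (- 1) * (inverse (f x) * frechet_derivative f (at x) v * inverse (f x))"]) auto
qed

section \<open>Closure properties of smooth maps\<close>

lemma smooth_on_cong:
  "open S \<Longrightarrow> smooth_on S f \<Longrightarrow> (\<And>x. x \<in> S \<Longrightarrow> f x = g x) \<Longrightarrow> smooth_on S g"
  unfolding smooth_on_def using Ck_on_cong by blast

lemma smooth_on_subset: "smooth_on S f \<Longrightarrow> T \<subseteq> S \<Longrightarrow> smooth_on T f"
  unfolding smooth_on_def using Ck_on_subset by blast

lemma smooth_on_const: "smooth_on S (\<lambda>x. a)"
  unfolding smooth_on_def using Ck_on_const by blast

lemma smooth_on_add:
  "open S \<Longrightarrow> smooth_on S f \<Longrightarrow> smooth_on S g \<Longrightarrow> smooth_on S (\<lambda>x. f x + g x)"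
  unfolding smooth_on_def using Ck_on_add by blast

lemma smooth_on_sum:
  "open S \<Longrightarrow> (\<And>i. i \<in> I \<Longrightarrow> smooth_on S (f i)) \<Longrightarrow> smooth_on S (\<lambda>x. \<Sum>i\<in>I. f i x)"
  by (induction I rule: infinite_finite_induct) (simp_all add: smooth_on_const smooth_on_add)

lemma smooth_on_bilinear:
  "bounded_bilinear pr \<Longrightarrow> open S \<Longrightarrow> smooth_on S f \<Longrightarrow> smooth_on S g
    \<Longrightarrow> smooth_on S (\<lambda>x. pr (f x) (g x))"
  unfolding smooth_on_def using Ck_on_bilinear by blast

lemmas smooth_on_mult = smooth_on_bilinear[OF bounded_bilinear_mult]
  and smooth_on_scaleR = smooth_on_bilinear[OF bounded_bilinear_scaleR]
  and smooth_on_inner = smooth_on_bilinear[OF bounded_bilinear_inner]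

lemma smooth_on_diff:
  assumes "open S" "smooth_on S f" "smooth_on S g"
  shows "smooth_on S (\<lambda>x. f x - g x)"
  using smooth_on_add[OF assms(1,2) smooth_on_scaleR[OF assms(1) smooth_on_const assms(3), of "- 1"]]
  by simp

lemma smooth_on_inverse:
  fixes f :: "'e::euclidean_space \<Rightarrow> real"
  shows "open S \<Longrightarrow> smooth_on S f \<Longrightarrow> (\<And>x. x \<in> S \<Longrightarrow> f x \<noteq> 0) \<Longrightarrow> smooth_on S (\<lambda>x. inverse (f x))"
  unfolding smooth_on_def using Ck_on_inverse by blast

lemma smooth_on_differentiable: "smooth_on S f \<Longrightarrow> x \<in> S \<Longrightarrow> f differentiable (at x)"
  unfolding smooth_on_def by (metis Ck_on.simps(2))

lemma smooth_on_has_derivative: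
  "smooth_on S f \<Longrightarrow> x \<in> S \<Longrightarrow> (f has_derivative frechet_derivative f (at x)) (at x)"
  using smooth_on_differentiable frechet_derivative_works by blast

lemma smooth_on_continuous_on: "smooth_on S f \<Longrightarrow> continuous_on S f"
  unfolding smooth_on_def using Ck_on_continuous_on by blast

lemma smooth_on_frechet_derivative:
  "smooth_on S f \<Longrightarrow> smooth_on S (\<lambda>x. frechet_derivative f (at x) v)"
  unfolding smooth_on_def using Ck_on.simps(2) by blast

text \<open>\<open>Ck_on\<close> controls derivatives in fixed directions only. Expanding by
  linearity makes a derivative along a varying direction a finite sum of products of smooth
  functions.\<close>

lemma frechet_derivative_basis:
  assumes "f differentiable (at x)"
  shows "frechet_derivative f (at x) v = (\<Sum>b\<in>Basis. (v \<bullet> b) *\<^sub>R frechet_derivative f (at x) b)"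
proof -
  interpret linear "frechet_derivative f (at x)"
    using assms by (rule linear_frechet_derivative)
  have "frechet_derivative f (at x) v = frechet_derivative f (at x) (\<Sum>b\<in>Basis. (v \<bullet> b) *\<^sub>R b)"
    by (simp add: euclidean_representation)
  then show ?thesis by (simp only: sum scaleR)
qed

section \<open>Symmetry of second derivatives\<close>

text \<open>Mean value theorem twice: in the direction \<open>u\<close> for the increment along
  \<open>v\<close>, then in the direction \<open>v\<close> for the derivative along
  \<open>u\<close>. The double difference on the left is symmetric in \<open>u\<close> and
  \<open>v\<close>.\<close>

lemma second_difference:
  fixes f :: "'e::euclidean_space \<Rightarrow> real"
  assumes "smooth_on S f" "h > 0"
    and box: "\<And>s t. 0 \<le> s \<Longrightarrow> s \<le> h \<Longrightarrow> 0 \<le> t \<Longrightarrow> t \<le> h \<Longrightarrow> x + s *\<^sub>R u + t *\<^sub>R v \<in> S"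
  obtains s t where "0 < s" "s < h" "0 < t" "t < h"
    "f (x + h *\<^sub>R u + h *\<^sub>R v) - f (x + h *\<^sub>R u) - f (x + h *\<^sub>R v) + f x
      = h * h * frechet_derivative (\<lambda>y. frechet_derivative f (at y) u) (at (x + s *\<^sub>R u + t *\<^sub>R v)) v"
proof -
  let ?D = "\<lambda>y. frechet_derivative f (at y)"
  let ?E = "\<lambda>y. frechet_derivative (\<lambda>y. ?D y u) (at y)"
  have D: "((\<lambda>s. f (x + s *\<^sub>R u + t *\<^sub>R v)) has_real_derivative ?D (x + s *\<^sub>R u + t *\<^sub>R v) u) (at s)"
    if "0 \<le> s" "s \<le> h" "0 \<le> t" "t \<le> h" for s t
  proof -
    have d: "(f has_derivative ?D (x + s *\<^sub>R u + t *\<^sub>R v)) (at (x + s *\<^sub>R u + t *\<^sub>R v))"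
      using assms(1) box[OF that] by (rule smooth_on_has_derivative)
    have "((\<lambda>s. x + s *\<^sub>R u + t *\<^sub>R v) has_derivative (\<lambda>r. r *\<^sub>R u)) (at s)"
      by (auto intro!: derivative_eq_intros)
    from has_derivative_compose[OF this d] show ?thesis
      by (simp add: has_field_derivative_def linear_cmul[OF has_derivative_linear[OF d]]
          mult_commute_abs)
  qed
  have E: "((\<lambda>t. ?D (x + s *\<^sub>R u + t *\<^sub>R v) u) has_real_derivative ?E (x + s *\<^sub>R u + t *\<^sub>R v) v) (at t)"
    if "0 \<le> s" "s \<le> h" "0 \<le> t" "t \<le> h" for s t
  proof -
    have d: "((\<lambda>y. ?D y u) has_derivative ?E (x + s *\<^sub>R u + t *\<^sub>R v)) (at (x + s *\<^sub>R u + t *\<^sub>R v))"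
      using smooth_on_frechet_derivative[OF assms(1)] box[OF that] by (rule smooth_on_has_derivative)
    have "((\<lambda>t. x + s *\<^sub>R u + t *\<^sub>R v) has_derivative (\<lambda>r. r *\<^sub>R v)) (at t)"
      by (auto intro!: derivative_eq_intros)
    from has_derivative_compose[OF this d] show ?thesis
      by (simp add: has_field_derivative_def linear_cmul[OF has_derivative_linear[OF d]]
          mult_commute_abs)
  qed
  \<comment> \<open>The zero multiples stay unsimplified so that \<open>D\<close> applies with t = 0
    as it does with t = h.\<close>
  have "\<exists>s. 0 < s \<and> s < h \<and> (f (x + h *\<^sub>R u + h *\<^sub>R v) - f (x + h *\<^sub>R u + 0 *\<^sub>R v))
      - (f (x + 0 *\<^sub>R u + h *\<^sub>R v) - f (x + 0 *\<^sub>R u + 0 *\<^sub>R v))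
      = (h - 0) * (?D (x + s *\<^sub>R u + h *\<^sub>R v) u - ?D (x + s *\<^sub>R u + 0 *\<^sub>R v) u)"
    by (rule MVT2[OF \<open>h > 0\<close>, of "\<lambda>s. f (x + s *\<^sub>R u + h *\<^sub>R v) - f (x + s *\<^sub>R u + 0 *\<^sub>R v)"])
       (use \<open>h > 0\<close> in \<open>auto intro!: DERIV_diff D simp del: scaleR_zero_left\<close>)
  then obtain s where s: "0 < s" "s < h"
    and "f (x + h *\<^sub>R u + h *\<^sub>R v) - f (x + h *\<^sub>R u) - f (x + h *\<^sub>R v) + f x
      = h * (?D (x + s *\<^sub>R u + h *\<^sub>R v) u - ?D (x + s *\<^sub>R u + 0 *\<^sub>R v) u)"
    by auto
  moreover have "\<exists>t. 0 < t \<and> t < h \<and> ?D (x + s *\<^sub>R u + h *\<^sub>R v) u - ?D (x + s *\<^sub>R u + 0 *\<^sub>R v) u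
      = (h - 0) * ?E (x + s *\<^sub>R u + t *\<^sub>R v) v"
    by (rule MVT2[OF \<open>h > 0\<close>]) (use s in \<open>auto intro!: E\<close>)
  then obtain t where "0 < t" "t < h" "?D (x + s *\<^sub>R u + h *\<^sub>R v) u - ?D (x + s *\<^sub>R u + 0 *\<^sub>R v) u
      = h * ?E (x + s *\<^sub>R u + t *\<^sub>R v) v"
    by auto
  ultimately show ?thesis
    using that[of s t] s by simp
qed

text \<open>Reading one double difference in both orders gives points arbitrarily close to
  \<open>x\<close> where the two mixed derivatives agree; by continuity their values at
  \<open>x\<close> cannot differ. Half of a supposed gap serves as \<epsilon>.\<close>

lemma second_derivative_symmetric:
  fixes f :: "'e::euclidean_space \<Rightarrow> real"
  assumes "open S" "smooth_on S f" "x \<in> S"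
  shows "frechet_derivative (\<lambda>y. frechet_derivative f (at y) u) (at x) v
       = frechet_derivative (\<lambda>y. frechet_derivative f (at y) v) (at x) u"
proof (rule ccontr)
  let ?E = "\<lambda>u v y. frechet_derivative (\<lambda>y. frechet_derivative f (at y) u) (at y) v"
  assume neq: "?E u v x \<noteq> ?E v u x"
  define \<epsilon> where "\<epsilon> = dist (?E u v x) (?E v u x) / 2"
  have "\<epsilon> > 0" using neq by (simp add: \<epsilon>_def)
  have cont: "isCont (?E u v) x" for u v
    using smooth_on_frechet_derivative[OF smooth_on_frechet_derivative[OF assms(2)]]
    by (metis assms(1,3) continuous_on_eq_continuous_at smooth_on_continuous_on)
  from cont[of u v] obtain d1 where d1: "d1 > 0"
    "\<And>y. dist y x < d1 \<Longrightarrow> dist (?E u v y) (?E u v x) < \<epsilon>"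
    using \<open>\<epsilon> > 0\<close> unfolding continuous_at_eps_delta by blast
  from cont[of v u] obtain d2 where d2: "d2 > 0"
    "\<And>y. dist y x < d2 \<Longrightarrow> dist (?E v u y) (?E v u x) < \<epsilon>"
    using \<open>\<epsilon> > 0\<close> unfolding continuous_at_eps_delta by blast
  obtain d3 where d3: "d3 > 0" "ball x d3 \<subseteq> S"
    using assms(1,3) open_contains_ball by blast
  define d where "d = Min {d1, d2, d3}"
  have "d > 0" and d: "d \<le> d1" "d \<le> d2" "d \<le> d3"
    using d1(1) d2(1) d3(1) by (auto simp: d_def)
  \<comment> \<open>This size keeps the parallelogram spanned by \<open>h *\<^sub>R u\<close> and
    \<open>h *\<^sub>R v\<close> at \<open>x\<close> inside the ball of radius \<open>d\<close>; the
    summand 1 avoids division by zero and makes the bound strict.\<close>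
  define h where "h = d / (norm u + norm v + 1)"
  have pos: "norm u + norm v + 1 > 0"
    by (simp add: add_nonneg_pos)
  have "h > 0" using \<open>d > 0\<close> pos by (simp add: h_def)
  have near: "dist (x + s *\<^sub>R u + t *\<^sub>R v) x < d" if "0 \<le> s" "s \<le> h" "0 \<le> t" "t \<le> h" for s t
  proof -
    have "dist (x + s *\<^sub>R u + t *\<^sub>R v) x = norm (s *\<^sub>R u + t *\<^sub>R v)"
      by (simp add: dist_norm algebra_simps)
    also have "\<dots> \<le> s * norm u + t * norm v"
      using norm_triangle_ineq[of "s *\<^sub>R u" "t *\<^sub>R v"] that by simp
    also have "\<dots> \<le> h * norm u + h * norm v"
      using that by (intro add_mono mult_right_mono) auto
    also have "\<dots> < h * (norm u + norm v + 1)"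
      using \<open>h > 0\<close> by (simp add: algebra_simps)
    also have "\<dots> = d" using pos by (simp add: h_def)
    finally show ?thesis .
  qed
  have inS: "x + s *\<^sub>R u + t *\<^sub>R v \<in> S" if "0 \<le> s" "s \<le> h" "0 \<le> t" "t \<le> h" for s t
    using near[OF that] d d3(2) by (auto simp: subset_iff dist_commute)
  obtain s t where st: "0 < s" "s < h" "0 < t" "t < h"
    "f (x + h *\<^sub>R u + h *\<^sub>R v) - f (x + h *\<^sub>R u) - f (x + h *\<^sub>R v) + f x
      = h * h * ?E u v (x + s *\<^sub>R u + t *\<^sub>R v)"
    using second_difference[OF assms(2) \<open>h > 0\<close> inS] by blast
  have inS': "x + t *\<^sub>R v + s *\<^sub>R u \<in> S" if "0 \<le> t" "t \<le> h" "0 \<le> s" "s \<le> h" for s t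
    using inS[of s t] that by (simp add: algebra_simps)
  obtain t' s' where st': "0 < t'" "t' < h" "0 < s'" "s' < h"
    "f (x + h *\<^sub>R v + h *\<^sub>R u) - f (x + h *\<^sub>R v) - f (x + h *\<^sub>R u) + f x
      = h * h * ?E v u (x + t' *\<^sub>R v + s' *\<^sub>R u)"
    using second_difference[OF assms(2) \<open>h > 0\<close> inS'] by blast
  have swap: "x + t' *\<^sub>R v + s' *\<^sub>R u = x + s' *\<^sub>R u + t' *\<^sub>R v"
    "x + h *\<^sub>R v + h *\<^sub>R u = x + h *\<^sub>R u + h *\<^sub>R v"
    by (simp_all add: algebra_simps)
  have "?E u v (x + s *\<^sub>R u + t *\<^sub>R v) = ?E v u (x + s' *\<^sub>R u + t' *\<^sub>R v)"
    using st(5) st'(5) \<open>h > 0\<close> unfolding swap by (smt (verit) mult_left_cancel mult_pos_pos)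
  moreover have "dist (?E u v (x + s *\<^sub>R u + t *\<^sub>R v)) (?E u v x) < \<epsilon>"
    using near[of s t] st d by (intro d1(2)) auto
  moreover have "dist (?E v u (x + s' *\<^sub>R u + t' *\<^sub>R v)) (?E v u x) < \<epsilon>"
    using near[of s' t'] st' d by (intro d2(2)) auto
  ultimately show False
    using dist_triangle3[of "?E u v x" "?E v u x" "?E v u (x + s' *\<^sub>R u + t' *\<^sub>R v)"]
    unfolding \<epsilon>_def by simp
qed

section \<open>Bivector fields on Euclidean space\<close>

definition lie :: "('e \<Rightarrow> 'e) \<Rightarrow> ('e::euclidean_space \<Rightarrow> real) \<Rightarrow> 'e \<Rightarrow> real" where
  "lie Z f x = frechet_derivative f (at x) (Z x)"

definition lie_bracket :: "('e \<Rightarrow> 'e) \<Rightarrow> ('e \<Rightarrow> 'e) \<Rightarrow> 'e::euclidean_space \<Rightarrow> 'e" where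
  "lie_bracket Z X x = frechet_derivative X (at x) (Z x) - frechet_derivative Z (at x) (X x)"

text \<open>The bivector field Z \<and> X acting as a biderivation on functions, so that nested
  applications are exactly the terms of the Schouten bracket.\<close>

definition wedge ::
  "('e \<Rightarrow> 'e) \<Rightarrow> ('e \<Rightarrow> 'e) \<Rightarrow> ('e::euclidean_space \<Rightarrow> real) \<Rightarrow> ('e \<Rightarrow> real) \<Rightarrow> 'e \<Rightarrow> real" where
  "wedge Z X f g x = lie Z f x * lie X g x - lie X f x * lie Z g x"

lemma smooth_on_lie:
  assumes "open S" "smooth_on S Z" "smooth_on S f"
  shows "smooth_on S (lie Z f)"
proof (rule smooth_on_cong[OF assms(1)])
  show "smooth_on S (\<lambda>x. \<Sum>b\<in>Basis. (Z x \<bullet> b) * frechet_derivative f (at x) b)"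
    using assms by (intro smooth_on_sum smooth_on_mult smooth_on_inner smooth_on_const
        smooth_on_frechet_derivative)
  show "(\<Sum>b\<in>Basis. (Z x \<bullet> b) * frechet_derivative f (at x) b) = lie Z f x" if "x \<in> S" for x
    using frechet_derivative_basis[OF smooth_on_differentiable[OF assms(3) that], of "Z x"]
    by (simp add: lie_def)
qed

lemma smooth_on_wedge:
  "open S \<Longrightarrow> smooth_on S Z \<Longrightarrow> smooth_on S X \<Longrightarrow> smooth_on S f \<Longrightarrow> smooth_on S g
    \<Longrightarrow> smooth_on S (wedge Z X f g)"
  unfolding wedge_def[abs_def] by (intro smooth_on_diff smooth_on_mult smooth_on_lie)

text \<open>Product rule for the basis expansion of \<open>lie Z f\<close>. The first summand
  differentiates df with the direction frozen at \<open>Z x\<close> and is a second derivative of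
  \<open>f\<close>; the second differentiates the field itself.\<close>

lemma lie_lie:
  assumes "open S" "smooth_on S Z" "smooth_on S f" "x \<in> S"
  shows "lie Y (lie Z f) x = frechet_derivative (\<lambda>y. frechet_derivative f (at y) (Z x)) (at x) (Y x)
    + frechet_derivative f (at x) (frechet_derivative Z (at x) (Y x))"
proof -
  let ?D = "\<lambda>b y. frechet_derivative f (at y) b"
  have D: "(?D b has_derivative frechet_derivative (?D b) (at x)) (at x)" for b
    using smooth_on_frechet_derivative[OF assms(3)] assms(4) by (rule smooth_on_has_derivative)
  have Z: "(Z has_derivative frechet_derivative Z (at x)) (at x)"
    using assms(2,4) by (rule smooth_on_has_derivative)
  note rep = frechet_derivative_basis[OF smooth_on_differentiable[OF assms(3)]]
  have "((\<lambda>y. \<Sum>b\<in>Basis. (Z y \<bullet> b) * ?D b y) has_derivative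
      (\<lambda>v. \<Sum>b\<in>Basis. (Z x \<bullet> b) * frechet_derivative (?D b) (at x) v
         + (frechet_derivative Z (at x) v \<bullet> b) * ?D b x)) (at x)"
    by (intro has_derivative_sum has_derivative_mult D has_derivative_inner_left Z)
  then have "(lie Z f has_derivative
      (\<lambda>v. \<Sum>b\<in>Basis. (Z x \<bullet> b) * frechet_derivative (?D b) (at x) v
         + (frechet_derivative Z (at x) v \<bullet> b) * ?D b x)) (at x)"
    by (rule has_derivative_transform_within_open[OF _ assms(1,4)]) (simp add: lie_def rep)
  then have 1: "lie Y (lie Z f) x = (\<Sum>b\<in>Basis. (Z x \<bullet> b) * frechet_derivative (?D b) (at x) (Y x)
         + (frechet_derivative Z (at x) (Y x) \<bullet> b) * ?D b x)"
    unfolding lie_def[of Y] by (simp flip: frechet_derivative_at)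
  \<comment> \<open>The same expansion with coefficients frozen at \<open>x\<close> identifies the
    second-derivative part.\<close>
  have "((\<lambda>y. \<Sum>b\<in>Basis. (Z x \<bullet> b) * ?D b y) has_derivative
      (\<lambda>v. \<Sum>b\<in>Basis. (Z x \<bullet> b) * frechet_derivative (?D b) (at x) v)) (at x)"
    by (intro has_derivative_sum has_derivative_mult_right D)
  then have "(?D (Z x) has_derivative
      (\<lambda>v. \<Sum>b\<in>Basis. (Z x \<bullet> b) * frechet_derivative (?D b) (at x) v)) (at x)"
    by (rule has_derivative_transform_within_open[OF _ assms(1,4)]) (simp add: rep[of _ "Z x"])
  then have 2: "frechet_derivative (?D (Z x)) (at x) (Y x)
      = (\<Sum>b\<in>Basis. (Z x \<bullet> b) * frechet_derivative (?D b) (at x) (Y x))"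
    by (simp flip: frechet_derivative_at)
  show ?thesis
    unfolding 1 2 rep[OF assms(4), of "frechet_derivative Z (at x) (Y x)"] by (simp add: sum.distrib)
qed

text \<open>The second-derivative parts of both iterated derivatives cancel by symmetry, leaving
  only the derivatives of the fields.\<close>

lemma lie_commutator:
  assumes "open S" "smooth_on S Z" "smooth_on S X" "smooth_on S f" "x \<in> S"
  shows "lie Z (lie X f) x - lie X (lie Z f) x = frechet_derivative f (at x) (lie_bracket Z X x)"
proof -
  have "linear (frechet_derivative f (at x))"
    using assms(4,5) by (intro linear_frechet_derivative smooth_on_differentiable)
  then show ?thesis
    unfolding lie_lie[OF assms(1,3,4,5)] lie_lie[OF assms(1,2,4,5)] lie_bracket_def
    using second_derivative_symmetric[OF assms(1,4,5), of "X x" "Z x"]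
    by (simp add: linear_diff)
qed

lemma lie_wedge:
  assumes "open S" "smooth_on S Z" "smooth_on S X" "smooth_on S f" "smooth_on S g" "x \<in> S"
  shows "lie Y (wedge Z X f g) x =
    lie Y (lie Z f) x * lie X g x + lie Z f x * lie Y (lie X g) x
    - lie Y (lie X f) x * lie Z g x - lie X f x * lie Y (lie Z g) x"
proof -
  have D: "(lie Z f has_derivative frechet_derivative (lie Z f) (at x)) (at x)"
    if "smooth_on S Z" "smooth_on S f" for Z f
    using smooth_on_lie[OF assms(1) that] assms(6) by (rule smooth_on_has_derivative)
  have "(wedge Z X f g has_derivative (\<lambda>v.
      (lie Z f x * frechet_derivative (lie X g) (at x) v + frechet_derivative (lie Z f) (at x) v * lie X g x)
      - (lie X f x * frechet_derivative (lie Z g) (at x) v + frechet_derivative (lie X f) (at x) v * lie Z g x))) (at x)"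
    unfolding wedge_def[abs_def]
    by (intro has_derivative_diff has_derivative_mult D assms)
  from frechet_derivative_at[OF this] show ?thesis
    unfolding lie_def[of Y] by (metis (no_types, lifting) add_diff_eq add.commute diff_diff_add)
qed

text \<open>Up to sign, \<open>[Z \<and> X, W \<and> X]\<close> is \<open>[Z, X] \<and> X \<and> W + [W, X] \<and> X \<and> Z\<close>: the term with \<open>[Z, W]\<close>
  carries the factor \<open>X \<and> X\<close>.\<close>

lemma schouten_wedge:
  assumes S: "open S" "x \<in> S"
    and smooth: "smooth_on S Z" "smooth_on S W" "smooth_on S X"
      "smooth_on S f" "smooth_on S g" "smooth_on S h"
    and Z: "lie_bracket Z X x = a *\<^sub>R X x \<or> X x = 0"
    and W: "lie_bracket W X x = b *\<^sub>R X x \<or> X x = 0"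
  shows "wedge Z X (wedge W X f g) h x - wedge Z X (wedge W X f h) g x + wedge Z X (wedge W X g h) f x
       + wedge W X (wedge Z X f g) h x - wedge W X (wedge Z X f h) g x + wedge W X (wedge Z X g h) f x
       = 0"
proof (cases "X x = 0")
  case True
  \<comment> \<open>Every summand of the claim has a derivative along \<open>X\<close> at
    \<open>x\<close> as a factor.\<close>
  have "lie X u x = 0" if "smooth_on S u" for u
    unfolding lie_def True
    by (rule linear_0) (rule linear_frechet_derivative[OF smooth_on_differentiable[OF that S(2)]])
  then show ?thesis
    using smooth S(1) by (simp add: wedge_def smooth_on_wedge)
next
  case False
  \<comment> \<open>The bracket hypothesis moves \<open>X\<close> past \<open>Y\<close> at the cost
    of a first-order term along \<open>X\<close>.\<close>
  have com: "lie X (lie Y u) x = lie Y (lie X u) x - c * lie X u x"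
    if "smooth_on S Y" "smooth_on S u" "lie_bracket Y X x = c *\<^sub>R X x" for Y u c
  proof -
    have "linear (frechet_derivative u (at x))"
      using that S by (intro linear_frechet_derivative smooth_on_differentiable)
    then show ?thesis
      using lie_commutator[OF S(1) that(1) smooth(3) that(2) S(2)] that(3)
      by (simp add: lie_def linear_cmul)
  qed
  note com_Z = com[OF smooth(1) _ Z[simplified False simp_thms]]
    and com_W = com[OF smooth(2) _ W[simplified False simp_thms]]
  \<comment> \<open>Once \<open>X\<close> is always the inner derivative, the claim is a polynomial
    identity in first and second derivatives at \<open>x\<close>. The second derivatives along
    \<open>Z\<close> and \<open>W\<close> cancel in the alternating sum.\<close>
  show ?thesis
    unfolding wedge_def[of _ _ "wedge _ _ _ _"]
    by (simp only: lie_wedge[OF S(1) smooth(1) smooth(3) _ _ S(2)]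
        lie_wedge[OF S(1) smooth(2) smooth(3) _ _ S(2)] smooth(4-6)
        com_Z[OF smooth(4)] com_Z[OF smooth(5)] com_Z[OF smooth(6)]
        com_W[OF smooth(4)] com_W[OF smooth(5)] com_W[OF smooth(6)]) algebra
qed

section \<open>Linear algebra\<close>

lemma lin_indep_SucD:
  fixes g :: "nat \<Rightarrow> 'v::real_vector"
  assumes "lin_indep (Suc n) g"
  shows "lin_indep n g" "g n \<notin> span (g ` {..<n})"
proof -
  show "lin_indep n g"
    unfolding lin_indep_def
  proof (intro allI impI)
    fix a :: "nat \<Rightarrow> real" and i
    assume "(\<Sum>i<n. a i *\<^sub>R g i) = 0" "i < n"
    then have "(\<Sum>i<Suc n. (a(n := 0)) i *\<^sub>R g i) = 0"
      by simp
    then have "(a(n := 0)) i = 0"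
      using assms \<open>i < n\<close> unfolding lin_indep_def by (metis less_SucI)
    then show "a i = 0" using \<open>i < n\<close> by simp
  qed
  \<comment> \<open>The linear combinations indexed by the family form a subspace containing each
    \<open>g j\<close>, hence contain the span; so membership in the span yields
    coefficients.\<close>
  have "subspace {\<Sum>i<n. a i *\<^sub>R g i | a. True}"
  proof (intro subspaceI; clarify)
    show "\<exists>a. (0::'v) = (\<Sum>i<n. a i *\<^sub>R g i) \<and> True"
      by (rule exI[of _ "\<lambda>_. 0"]) simp
    show "\<exists>c. (\<Sum>i<n. a i *\<^sub>R g i) + (\<Sum>i<n. b i *\<^sub>R g i) = (\<Sum>i<n. c i *\<^sub>R g i) \<and> True" for a b
      by (rule exI[of _ "\<lambda>i. a i + b i"]) (simp add: scaleR_add_left sum.distrib)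
    show "\<exists>b. r *\<^sub>R (\<Sum>i<n. a i *\<^sub>R g i) = (\<Sum>i<n. b i *\<^sub>R g i) \<and> True" for r a
      by (rule exI[of _ "\<lambda>i. r * a i"]) (simp add: scaleR_sum_right)
  qed
  moreover have "g j \<in> {\<Sum>i<n. a i *\<^sub>R g i | a. True}" if "j < n" for j
  proof -
    have "g j = (\<Sum>i<n. (if i = j then 1 else 0) *\<^sub>R g i)"
      using that by (simp add: if_distrib[of "\<lambda>r. r *\<^sub>R _"] cong: if_cong)
    then show ?thesis by (intro CollectI exI conjI TrueI)
  qed
  ultimately have span: "span (g ` {..<n}) \<subseteq> {\<Sum>i<n. a i *\<^sub>R g i | a. True}"
    by (intro span_minimal) auto
  show "g n \<notin> span (g ` {..<n})"
  proof
    assume "g n \<in> span (g ` {..<n})"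
    then obtain a where "g n = (\<Sum>i<n. a i *\<^sub>R g i)" using span by blast
    then have "(\<Sum>i<Suc n. (a(n := - 1)) i *\<^sub>R g i) = 0" by simp
    then have "(a(n := - 1)) n = 0"
      using assms unfolding lin_indep_def by blast
    then show False by simp
  qed
qed

text \<open>Independence of the family also forbids repetitions. The cardinality records this and is
  what dimension counting needs.\<close>

lemma lin_indep_independent:
  "lin_indep n g \<Longrightarrow> independent (g ` {..<n}) \<and> card (g ` {..<n}) = n"
proof (induction n)
  case 0
  show ?case by (simp add: independent_empty)
next
  case (Suc n)
  note * = lin_indep_SucD[OF Suc.prems]
  have "g n \<notin> g ` {..<n}" using *(2) by (rule contra_subsetD[OF span_superset])
  then show ?case
    unfolding lessThan_Suc image_insert
    using Suc.IH[OF *(1)] independent_insertI[OF *(2)] by simp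
qed

text \<open>\<open>u\<close> is orthogonal to the span of the \<open>g i\<close> and nonzero, so
  together they are a basis by counting. A vector orthogonal to all of them vanishes.\<close>

lemma orthogonal_line:
  fixes g :: "nat \<Rightarrow> 'e::euclidean_space"
  assumes indep: "lin_indep (DIM('e) - 1) g"
    and u: "\<And>i. i < DIM('e) - 1 \<Longrightarrow> g i \<bullet> u = 0" "u \<noteq> 0"
    and w: "\<And>i. i < DIM('e) - 1 \<Longrightarrow> g i \<bullet> w = 0"
  obtains r where "w = r *\<^sub>R u"
proof -
  define B where "B = g ` {..<DIM('e) - 1}"
  have B: "independent B" "card B = DIM('e) - 1" "finite B"
    using lin_indep_independent[OF indep] by (auto simp: B_def)
  have "u \<notin> span B"
  proof
    assume "u \<in> span B"
    then have "orthogonal u u"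
      by (rule orthogonal_to_span) (use u(1) in \<open>auto simp: B_def orthogonal_def inner_commute\<close>)
    then show False using u(2) by (simp add: orthogonal_self)
  qed
  then have "independent (insert u B)" "card (insert u B) = DIM('e)"
    using B span_base[of u B] by (auto simp: independent_insertI card_insert_if Suc_leI)
  then have span: "span (insert u B) = UNIV"
    using card_ge_dim_independent[of "insert u B" UNIV] by auto
  \<comment> \<open>Removing the projection onto \<open>u\<close> leaves a vector orthogonal to the
    whole basis, hence to itself.\<close>
  define w' where "w' = w - ((w \<bullet> u) / (u \<bullet> u)) *\<^sub>R u"
  have "w' \<in> span (insert u B)" by (simp add: span)
  then have "orthogonal w' w'"
    by (rule orthogonal_to_span)
       (use u w in \<open>auto simp: B_def w'_def orthogonal_def inner_commute inner_diff_left inner_diff_right\<close>)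
  then show ?thesis using that by (simp add: orthogonal_self w'_def)
qed

text \<open>Gram-Schmidt, phrased so that the induction only ever divides by a nonzero scalar function:
  the new vector \<open>w\<close> is the component of \<open>g n\<close> orthogonal to the earlier vectors, and keeping the dual
  frame in their span gives \<open>w \<bullet> g n = w \<bullet> w\<close>.\<close>

lemma smooth_dual_frame:
  fixes g :: "nat \<Rightarrow> 'e::euclidean_space \<Rightarrow> 'e"
  assumes "open S" "\<And>i. i < n \<Longrightarrow> smooth_on S (g i)" "\<And>x. x \<in> S \<Longrightarrow> lin_indep n (\<lambda>i. g i x)"
  shows "\<exists>Z. (\<forall>i<n. smooth_on S (Z i)) \<and>
    (\<forall>x\<in>S. \<forall>i<n. Z i x \<in> span ((\<lambda>i. g i x) ` {..<n}) \<and>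
      (\<forall>j<n. g j x \<bullet> Z i x = (if j = i then 1 else 0)))"
  using assms(2,3)
proof (induction n)
  case 0
  show ?case by (rule exI[of _ "\<lambda>_ _. 0"]) simp
next
  case (Suc n)
  have "\<exists>Z. (\<forall>i<n. smooth_on S (Z i)) \<and>
    (\<forall>x\<in>S. \<forall>i<n. Z i x \<in> span ((\<lambda>i. g i x) ` {..<n}) \<and>
      (\<forall>j<n. g j x \<bullet> Z i x = (if j = i then 1 else 0)))"
    by (rule Suc.IH; rule Suc.prems lin_indep_SucD(1)[OF Suc.prems(2)]; simp)
  then obtain Z where Z': "(\<forall>i<n. smooth_on S (Z i)) \<and>
    (\<forall>x\<in>S. \<forall>i<n. Z i x \<in> span ((\<lambda>i. g i x) ` {..<n}) \<and>
      (\<forall>j<n. g j x \<bullet> Z i x = (if j = i then 1 else 0)))"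
    by (rule exE)
  have Z: "\<And>i. i < n \<Longrightarrow> smooth_on S (Z i)"
    "\<And>x i. x \<in> S \<Longrightarrow> i < n \<Longrightarrow> Z i x \<in> span ((\<lambda>i. g i x) ` {..<n})"
    "\<And>x i j. x \<in> S \<Longrightarrow> i < n \<Longrightarrow> j < n \<Longrightarrow> g j x \<bullet> Z i x = (if j = i then 1 else 0)"
    using Z' by simp_all
  define w where "w x = g n x - (\<Sum>j<n. (g n x \<bullet> g j x) *\<^sub>R Z j x)" for x
  \<comment> \<open>The new dual vector is \<open>w\<close> rescaled. The old ones lose a multiple
    of \<open>w\<close> to make their pairing with \<open>g n\<close> vanish, which leaves the
    earlier pairings intact because \<open>w\<close> is orthogonal to those
    \<open>g j\<close>.\<close>
  define Z' where "Z' i = (if i = n then \<lambda>x. inverse (g n x \<bullet> w x) *\<^sub>R w x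
      else (\<lambda>x. Z i x - ((g n x \<bullet> Z i x) * inverse (g n x \<bullet> w x)) *\<^sub>R w x))" for i
  have w_smooth: "smooth_on S w"
    unfolding w_def[abs_def] using Suc.prems(1) Z(1)
    by (intro smooth_on_diff smooth_on_sum smooth_on_scaleR smooth_on_inner assms(1)) auto
  have sum_span: "(\<Sum>j<n. (g n x \<bullet> g j x) *\<^sub>R Z j x) \<in> span ((\<lambda>i. g i x) ` {..<n})" if "x \<in> S" for x
    using Z(2)[OF that] by (intro span_sum span_scale) auto
  have w_orth: "g j x \<bullet> w x = 0" if "x \<in> S" "j < n" for x j
  proof -
    have "(\<Sum>k<n. (g n x \<bullet> g k x) * (g j x \<bullet> Z k x)) = (\<Sum>k<n. if k = j then g n x \<bullet> g k x else 0)"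
      using Z(3) that by (intro sum.cong) auto
    then show ?thesis
      using that by (simp add: w_def inner_diff_right inner_sum_right inner_commute)
  qed
  have w_nz: "g n x \<bullet> w x \<noteq> 0" if x: "x \<in> S" for x
  proof -
    have "orthogonal (w x) (\<Sum>j<n. (g n x \<bullet> g j x) *\<^sub>R Z j x)"
      by (rule orthogonal_to_span[OF sum_span[OF x]])
         (use w_orth x in \<open>auto simp: orthogonal_def inner_commute\<close>)
    then have "g n x \<bullet> w x = w x \<bullet> w x"
      by (simp add: w_def[of x] orthogonal_def inner_diff_left inner_diff_right inner_commute)
    moreover have "w x \<noteq> 0"
    proof
      assume "w x = 0"
      then have "g n x = (\<Sum>j<n. (g n x \<bullet> g j x) *\<^sub>R Z j x)"
        unfolding w_def by (rule eq_iff_diff_eq_0[THEN iffD2])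
      then show False
        using lin_indep_SucD(2)[OF Suc.prems(2)[OF x]] sum_span[OF x] by metis
    qed
    ultimately show ?thesis by simp
  qed
  have span_mono': "span ((\<lambda>i. g i x) ` {..<n}) \<subseteq> span ((\<lambda>i. g i x) ` {..<Suc n})" for x
    by (intro span_mono image_mono) auto
  have w_span: "w x \<in> span ((\<lambda>i. g i x) ` {..<Suc n})" if "x \<in> S" for x
    unfolding w_def
    by (intro span_diff span_base subsetD[OF span_mono' sum_span[OF that]]) simp
  show ?case
  proof (intro exI[of _ Z'] conjI allI impI ballI)
    fix i assume "i < Suc n"
    then consider "i = n" | "i < n" by linarith
    then show "smooth_on S (Z' i)"
    proof cases
      case 1
      have "smooth_on S (\<lambda>x. inverse (g n x \<bullet> w x) *\<^sub>R w x)"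
        by (intro smooth_on_scaleR smooth_on_inverse smooth_on_inner assms(1) w_smooth w_nz
            Suc.prems(1)) simp_all
      then show ?thesis by (simp only: 1 Z'_def if_True simp_thms)
    next
      case 2
      have "smooth_on S (\<lambda>x. Z i x - ((g n x \<bullet> Z i x) * inverse (g n x \<bullet> w x)) *\<^sub>R w x)"
        by (intro smooth_on_diff smooth_on_mult smooth_on_scaleR smooth_on_inverse smooth_on_inner
            assms(1) w_smooth w_nz Z(1)[OF 2] Suc.prems(1)) simp_all
      then show ?thesis using 2 by (simp add: Z'_def)
    qed
  next
    fix x i assume x: "x \<in> S" and "i < Suc n"
    then consider "i = n" | "i < n" by linarith
    then show "Z' i x \<in> span ((\<lambda>i. g i x) ` {..<Suc n})"
    proof cases
      case 1
      then show ?thesis by (simp only: Z'_def if_True simp_thms span_scale[OF w_span[OF x]])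
    next
      case 2
      have "Z i x \<in> span ((\<lambda>i. g i x) ` {..<Suc n})"
        using Z(2)[OF x 2] span_mono' by (rule set_mp[rotated])
      then have "Z i x - ((g n x \<bullet> Z i x) * inverse (g n x \<bullet> w x)) *\<^sub>R w x
          \<in> span ((\<lambda>i. g i x) ` {..<Suc n})"
        by (intro span_diff span_scale w_span x)
      then show ?thesis using 2 by (simp add: Z'_def)
    qed
  next
    fix x i j assume x: "x \<in> S" and "i < Suc n" "j < Suc n"
    then consider "i = n" "j = n" | "i = n" "j < n" | "i < n" "j = n" | "i < n" "j < n" by linarith
    then show "g j x \<bullet> Z' i x = (if j = i then 1 else 0)"
      using w_nz[OF x] w_orth[OF x, of j] Z(3)[OF x, of i j]
      by cases (simp_all add: Z'_def inner_diff_right)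
  qed
qed

section \<open>Tangent and cotangent spaces in a chart\<close>

lemma sum_fun_apply: "(\<Sum>i\<in>I. f i) x = (\<Sum>i\<in>I. f i x)"
  for f :: "'i \<Rightarrow> 'a \<Rightarrow> 'b::comm_monoid_add"
  by (induction I rule: infinite_finite_induct) auto

lemma scaleR_fun_apply: "(r *\<^sub>R f) x = r *\<^sub>R f x"
  by (simp add: scaleR_fun_def)

section \<open>Charts and transition maps\<close>

lemma chart_inv_chart_map: "is_chart c \<Longrightarrow> p \<in> chart_dom c \<Longrightarrow> chart_inv c (chart_map c p) = p"
  by (simp add: is_chart_def homeomorphism_def)

lemma open_chart_image:
  assumes "is_chart c" "open V"
  shows "open (chart_map c ` (chart_dom c \<inter> V))"
proof -
  have "openin (top_of_set (chart_map c ` chart_dom c)) (chart_map c ` (chart_dom c \<inter> V))"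
    using assms by (intro homeomorphism_imp_open_map[of "chart_dom c" _ "chart_map c" "chart_inv c"])
      (auto simp: is_chart_def openin_open)
  then show ?thesis
    using assms(1) by (auto simp: is_chart_def openin_open_eq)
qed

locale manifold =
  fixes A :: "('a::{second_countable_topology, t2_space}, 'e::euclidean_space) chart set"
  assumes smooth_manifold: "smooth_manifold A"
begin

lemma chart: "c \<in> A \<Longrightarrow> is_chart c"
  using smooth_manifold by (simp add: smooth_manifold_def)

lemmas inv_map [simp] = chart_inv_chart_map[OF chart]
  and open_image = open_chart_image[OF chart]

lemma open_overlap:
  "c \<in> A \<Longrightarrow> d \<in> A \<Longrightarrow> open (chart_map c ` (chart_dom c \<inter> chart_dom d))"
  using chart by (intro open_image) (auto simp: is_chart_def)

lemma transition_differentiable: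
  assumes "c \<in> A" "d \<in> A" "p \<in> chart_dom c" "p \<in> chart_dom d"
  shows "(chart_map d \<circ> chart_inv c) differentiable (at (chart_map c p))"
proof -
  have "smooth_on (chart_map c ` (chart_dom c \<inter> chart_dom d)) (chart_map d \<circ> chart_inv c)"
    using smooth_manifold assms by (auto simp: smooth_manifold_def)
  then show ?thesis
    using assms by (rule_tac smooth_on_differentiable) auto
qed

text \<open>Chain rule for the factorization of \<open>f \<circ> chart_inv c\<close> through the
  chart \<open>d\<close>, valid only on the overlap, which is open. It is the source of all chart
  independence below.\<close>

lemma transition_frechet_derivative:
  assumes "c \<in> A" "d \<in> A" "p \<in> chart_dom c" "p \<in> chart_dom d"
    and "(f \<circ> chart_inv d) differentiable (at (chart_map d p))"
  shows "frechet_derivative (f \<circ> chart_inv c) (at (chart_map c p)) v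
    = frechet_derivative (f \<circ> chart_inv d) (at (chart_map d p))
        (frechet_derivative (chart_map d \<circ> chart_inv c) (at (chart_map c p)) v)"
proof -
  let ?\<tau> = "chart_map d \<circ> chart_inv c"
  have \<tau>: "?\<tau> differentiable (at (chart_map c p))"
    using assms by (intro transition_differentiable)
  have \<tau>p: "?\<tau> (chart_map c p) = chart_map d p"
    using assms by simp
  have diff: "(f \<circ> chart_inv d) differentiable (at (?\<tau> (chart_map c p)))"
    using assms(5) by (simp only: \<tau>p)
  have "frechet_derivative (f \<circ> chart_inv c) (at (chart_map c p))
      = frechet_derivative ((f \<circ> chart_inv d) \<circ> ?\<tau>) (at (chart_map c p))"
    using assms diff \<tau>
    by (intro frechet_derivative_transform_within_open[OF _ open_overlap[of c d], symmetric]
        differentiable_chain_at) auto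
  also have "\<dots> = frechet_derivative (f \<circ> chart_inv d) (at (chart_map d p))
      \<circ> frechet_derivative ?\<tau> (at (chart_map c p))"
    using frechet_derivative_compose[OF \<tau> diff] by (simp only: \<tau>p)
  finally show ?thesis by simp
qed

section \<open>Tangent vectors and their components\<close>

lemma tangent_space_transition:
  "v \<in> tangent_space A p \<Longrightarrow> c \<in> A \<Longrightarrow> d \<in> A \<Longrightarrow> p \<in> chart_dom c \<Longrightarrow> p \<in> chart_dom d \<Longrightarrow>
    v d = frechet_derivative (chart_map d \<circ> chart_inv c) (at (chart_map c p)) (v c)"
  unfolding tangent_space_def by blast

lemma tangent_space_outside: "v \<in> tangent_space A p \<Longrightarrow> \<not> (c \<in> A \<and> p \<in> chart_dom c) \<Longrightarrow> v c = 0"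
  unfolding tangent_space_def by blast

lemma tangent_spaceI:
  assumes "\<And>c d. c \<in> A \<Longrightarrow> d \<in> A \<Longrightarrow> p \<in> chart_dom c \<Longrightarrow> p \<in> chart_dom d \<Longrightarrow>
      v d = frechet_derivative (chart_map d \<circ> chart_inv c) (at (chart_map c p)) (v c)"
    and "\<And>c. \<not> (c \<in> A \<and> p \<in> chart_dom c) \<Longrightarrow> v c = 0"
  shows "v \<in> tangent_space A p"
  unfolding tangent_space_def using assms by (intro CollectI conjI ballI allI impI) blast+

text \<open>Transport \<open>u\<close> to every other chart by the derivative of the transition map;
  the chain rule makes these components compatible.\<close>

lemma tangent_space_lift:
  assumes "c \<in> A" "p \<in> chart_dom c"
  obtains v where "v \<in> tangent_space A p" "v c = u"
proof -
  let ?D = "\<lambda>d. frechet_derivative (chart_map d \<circ> chart_inv c) (at (chart_map c p))"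
  define v where "v d = (if d \<in> A \<and> p \<in> chart_dom d then ?D d u else 0)" for d
  have "v e = frechet_derivative (chart_map e \<circ> chart_inv d) (at (chart_map d p)) (v d)"
    if "d \<in> A" "e \<in> A" "p \<in> chart_dom d" "p \<in> chart_dom e" for d e
    using transition_frechet_derivative[OF assms(1) that(1) assms(2) that(3)
        transition_differentiable[OF that], of u] that
    by (simp add: v_def)
  then have "v \<in> tangent_space A p"
    by (rule tangent_spaceI) (auto simp: v_def)
  moreover have "v c = u"
  proof -
    \<comment> \<open>The transition map of a chart to itself is the identity near the
      point.\<close>
    have "?D c = frechet_derivative (\<lambda>x. x) (at (chart_map c p))"
      using assms open_overlap[of c c]
      by (intro frechet_derivative_transform_within_open[symmetric]) auto
    then show ?thesis using assms by (simp add: v_def)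
  qed
  ultimately show ?thesis by (rule that)
qed

text \<open>Together with \<open>tangent_space_lift\<close>, this makes evaluation in one chart an
  isomorphism of the tangent space with the model space.\<close>

lemma tangent_space_eqI:
  assumes "v \<in> tangent_space A p" "w \<in> tangent_space A p" "c \<in> A" "p \<in> chart_dom c" "v c = w c"
  shows "v = w"
proof
  fix d
  show "v d = w d"
  proof (cases "d \<in> A \<and> p \<in> chart_dom d")
    case True
    then show ?thesis
      using tangent_space_transition[OF assms(1,3) _ assms(4), of d]
        tangent_space_transition[OF assms(2,3) _ assms(4), of d] assms(5) by simp
  next
    case False
    then show ?thesis using assms(1,2) by (simp add: tangent_space_outside)
  qed
qed

lemma subspace_tangent_space: "subspace (tangent_space A p)"
proof (rule subspaceI)
  have lin: "linear (frechet_derivative (chart_map d \<circ> chart_inv c) (at (chart_map c p)))"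
    if "c \<in> A" "d \<in> A" "p \<in> chart_dom c" "p \<in> chart_dom d" for c d
    using that by (intro linear_frechet_derivative transition_differentiable)
  show "0 \<in> tangent_space A p"
    by (rule tangent_spaceI) (simp_all add: linear_0 lin)
  show "v + w \<in> tangent_space A p" if v: "v \<in> tangent_space A p" and w: "w \<in> tangent_space A p" for v w
  proof -
    have "(v + w) d = frechet_derivative (chart_map d \<circ> chart_inv c) (at (chart_map c p)) ((v + w) c)"
      if "c \<in> A" "d \<in> A" "p \<in> chart_dom c" "p \<in> chart_dom d" for c d
      unfolding plus_fun_def tangent_space_transition[OF v that] tangent_space_transition[OF w that]
      by (rule linear_add[OF lin[OF that], symmetric])
    then show ?thesis
      by (rule tangent_spaceI) (simp_all add: tangent_space_outside[OF v] tangent_space_outside[OF w])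
  qed
  show "r *\<^sub>R v \<in> tangent_space A p" if v: "v \<in> tangent_space A p" for r v
  proof -
    have "(r *\<^sub>R v) d = frechet_derivative (chart_map d \<circ> chart_inv c) (at (chart_map c p)) ((r *\<^sub>R v) c)"
      if "c \<in> A" "d \<in> A" "p \<in> chart_dom c" "p \<in> chart_dom d" for c d
      unfolding scaleR_fun_apply tangent_space_transition[OF v that]
      by (rule linear_cmul[OF lin[OF that], symmetric])
    then show ?thesis
      by (rule tangent_spaceI) (simp_all add: scaleR_fun_apply tangent_space_outside[OF v])
  qed
qed

lemmas tangent_space_add = subspace_add[OF subspace_tangent_space]
  and tangent_space_diff = subspace_diff[OF subspace_tangent_space]
  and tangent_space_scale = subspace_scale[OF subspace_tangent_space]

section \<open>Differentials, covectors and the sharp map\<close>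

text \<open>The transformation rule of \<open>v\<close> matches the chain rule for \<open>f\<close>,
  so the chart picked by \<open>SOME\<close> in \<open>differential\<close> may be replaced by any
  chart around \<open>p\<close>.\<close>

lemma differential_chart:
  assumes "c \<in> A" "p \<in> chart_dom c" "(f \<circ> chart_inv c) differentiable (at (chart_map c p))"
    and "v \<in> tangent_space A p"
  shows "differential A f p v = frechet_derivative (f \<circ> chart_inv c) (at (chart_map c p)) (v c)"
proof -
  define d where "d = (SOME c. c \<in> A \<and> p \<in> chart_dom c)"
  have d: "d \<in> A" "p \<in> chart_dom d"
    using someI[of "\<lambda>c. c \<in> A \<and> p \<in> chart_dom c" c] assms by (auto simp: d_def)
  have "differential A f p v = frechet_derivative (f \<circ> chart_inv d) (at (chart_map d p)) (v d)"
    using assms(4) by (simp add: differential_def d_def Let_def)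
  also have "\<dots> = frechet_derivative (f \<circ> chart_inv c) (at (chart_map c p)) (v c)"
    using transition_frechet_derivative[OF d(1) assms(1) d(2) assms(2,3)]
      tangent_space_transition[OF assms(4) d(1) assms(1) d(2) assms(2)] by simp
  finally show ?thesis .
qed

lemma cotangent_spaceI:
  assumes "c \<in> A" "p \<in> chart_dom c" "linear l"
  shows "(\<lambda>v. if v \<in> tangent_space A p then l (v c) else 0) \<in> cotangent_space A p"
  using assms(3) unfolding cotangent_space_def
  by (auto simp: tangent_space_add tangent_space_scale linear_add scaleR_fun_apply linear_cmul)

lemma differential_cotangent:
  assumes "c \<in> A" "p \<in> chart_dom c" "(f \<circ> chart_inv c) differentiable (at (chart_map c p))"
  shows "differential A f p \<in> cotangent_space A p"
proof -
  have "differential A f p = (\<lambda>v. if v \<in> tangent_space A p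
      then frechet_derivative (f \<circ> chart_inv c) (at (chart_map c p)) (v c) else 0)"
    using differential_chart[OF assms] by (auto simp: differential_def)
  then show ?thesis
    using cotangent_spaceI[OF assms(1,2) linear_frechet_derivative[OF assms(3)]] by simp
qed

lemma cotangent_add:
  "\<alpha> \<in> cotangent_space A p \<Longrightarrow> v \<in> tangent_space A p \<Longrightarrow> w \<in> tangent_space A p \<Longrightarrow> \<alpha> (v + w) = \<alpha> v + \<alpha> w"
  by (simp add: cotangent_space_def)

lemma cotangent_scale:
  "\<alpha> \<in> cotangent_space A p \<Longrightarrow> v \<in> tangent_space A p \<Longrightarrow> \<alpha> (r *\<^sub>R v) = r * \<alpha> v"
  by (simp add: cotangent_space_def)

lemma cotangent_diff:
  assumes "\<alpha> \<in> cotangent_space A p" "v \<in> tangent_space A p" "w \<in> tangent_space A p"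
  shows "\<alpha> (v - w) = \<alpha> v - \<alpha> w"
  using cotangent_add[OF assms(1,2) tangent_space_scale[OF assms(3), of "- 1"]]
    cotangent_scale[OF assms(1,3), of "- 1"] by simp

text \<open>The coordinate covectors of a single chart already separate tangent vectors.\<close>

lemma cotangent_separates:
  assumes "p \<in> manifold_carrier A" "v \<in> tangent_space A p" "w \<in> tangent_space A p"
    and "\<And>\<alpha>. \<alpha> \<in> cotangent_space A p \<Longrightarrow> \<alpha> v = \<alpha> w"
  shows "v = w"
proof -
  obtain c where c: "c \<in> A" "p \<in> chart_dom c"
    using assms(1) by (auto simp: manifold_carrier_def)
  have "v c \<bullet> b = w c \<bullet> b" for b
    using assms(4)[OF cotangent_spaceI[OF c, of "\<lambda>x. x \<bullet> b"]] assms(2,3)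
    by (simp add: bounded_linear.linear bounded_linear_inner_left)
  then show ?thesis
    by (intro tangent_space_eqI[OF assms(2,3) c]) (auto intro: euclidean_eqI)
qed

text \<open>Covectors separate tangent vectors, so the description in \<open>sharp\<close> has at
  most one solution and exhibiting one determines it.\<close>

lemma sharp_eqI:
  assumes "p \<in> manifold_carrier A" "v \<in> tangent_space A p"
    and "\<And>\<beta>. \<beta> \<in> cotangent_space A p \<Longrightarrow> \<beta> v = b \<alpha> \<beta>"
  shows "sharp A p b \<alpha> = v"
  unfolding sharp_def
proof (rule the_equality)
  show "v \<in> tangent_space A p \<and> (\<forall>\<beta>\<in>cotangent_space A p. \<beta> v = b \<alpha> \<beta>)"
    using assms by blast
  fix w assume "w \<in> tangent_space A p \<and> (\<forall>\<beta>\<in>cotangent_space A p. \<beta> w = b \<alpha> \<beta>)"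
  then show "w = v"
    using assms by (intro cotangent_separates[OF assms(1)]) auto
qed

lemma smooth_fun_differentiable:
  assumes "smooth_fun A V f" "c \<in> A" "p \<in> chart_dom c" "p \<in> V"
  shows "(f \<circ> chart_inv c) differentiable (at (chart_map c p))"
proof -
  have "smooth_on (chart_map c ` (chart_dom c \<inter> V)) (f \<circ> chart_inv c)"
    using assms by (simp add: smooth_fun_def)
  then show ?thesis using assms by (rule_tac smooth_on_differentiable) auto
qed

end

section \<open>Vector fields with a maximal number of independent first integrals\<close>

locale integrable_field = manifold A
  for A :: "('a::{second_countable_topology, t2_space}, 'e::euclidean_space) chart set" +
  fixes X :: "'a \<Rightarrow> ('a, 'e) chart \<Rightarrow> 'e" and F :: "nat \<Rightarrow> 'a \<Rightarrow> real" and U :: "'a set" and n :: nat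
  assumes smooth_X: "smooth_vector_field A (manifold_carrier A) X"
    and U: "open U" "U \<subseteq> manifold_carrier A"
    and n: "n = DIM('e) - 1"
    and integrals: "\<And>i. i < n \<Longrightarrow> first_integral A X (F i)"
    and indep: "independent_functions A U n F"
begin

section \<open>Coordinate expressions of the field and its integrals\<close>

definition loc :: "('a, 'e) chart \<Rightarrow> 'e set" where
  "loc c = chart_map c ` (chart_dom c \<inter> U)"

definition locX :: "('a, 'e) chart \<Rightarrow> 'e \<Rightarrow> 'e" where
  "locX c = (\<lambda>p. X p c) \<circ> chart_inv c"

definition locF :: "('a, 'e) chart \<Rightarrow> nat \<Rightarrow> 'e \<Rightarrow> real" where
  "locF c i = F i \<circ> chart_inv c"

text \<open>The Euclidean gradient in coordinates. It depends on the chart and serves only to bring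
  in orthogonality and Gram-Schmidt.\<close>

definition grad :: "('a, 'e) chart \<Rightarrow> nat \<Rightarrow> 'e \<Rightarrow> 'e" where
  "grad c i x = (\<Sum>b\<in>Basis. frechet_derivative (locF c i) (at x) b *\<^sub>R b)"

lemma open_loc: "c \<in> A \<Longrightarrow> open (loc c)"
  unfolding loc_def using U by (intro open_image)

lemma loc_subset: "loc c \<subseteq> chart_map c ` (chart_dom c \<inter> manifold_carrier A)"
  using U by (auto simp: loc_def)

lemma smooth_locX: "c \<in> A \<Longrightarrow> smooth_on (loc c) (locX c)"
  using smooth_X loc_subset unfolding smooth_vector_field_def locX_def
  by (blast intro: smooth_on_subset)

lemma smooth_locF: "c \<in> A \<Longrightarrow> i < n \<Longrightarrow> smooth_on (loc c) (locF c i)"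
  using integrals loc_subset unfolding first_integral_def smooth_fun_def locF_def
  by (blast intro: smooth_on_subset)

lemma tangent_X: "p \<in> U \<Longrightarrow> X p \<in> tangent_space A p"
  using smooth_X U unfolding smooth_vector_field_def by blast

lemma smooth_F: "i < n \<Longrightarrow> smooth_fun A U (F i)"
  using smooth_locF by (simp add: smooth_fun_def loc_def locF_def)

lemma locX [simp]: "c \<in> A \<Longrightarrow> p \<in> chart_dom c \<Longrightarrow> locX c (chart_map c p) = X p c"
  by (simp add: locX_def)

lemma differential_F:
  assumes "c \<in> A" "p \<in> chart_dom c" "p \<in> U" "i < n" "v \<in> tangent_space A p"
  shows "differential A (F i) p v = frechet_derivative (locF c i) (at (chart_map c p)) (v c)"
  unfolding locF_def using assms smooth_F by (intro differential_chart smooth_fun_differentiable)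

lemma grad_inner:
  assumes "c \<in> A" "i < n" "x \<in> loc c"
  shows "grad c i x \<bullet> v = frechet_derivative (locF c i) (at x) v"
  using frechet_derivative_basis[OF smooth_on_differentiable[OF smooth_locF[OF assms(1,2)] assms(3)], of v]
  by (simp add: grad_def inner_sum_left mult.commute inner_commute[of v])

lemma locF_locX:
  assumes "c \<in> A" "i < n" "x \<in> loc c"
  shows "frechet_derivative (locF c i) (at x) (locX c x) = 0"
proof -
  obtain p where p: "x = chart_map c p" "p \<in> chart_dom c" "p \<in> U"
    using assms(3) by (auto simp: loc_def)
  have "differential A (F i) p (X p) = 0"
    using integrals[OF assms(2)] p U by (auto simp: first_integral_def)
  then show ?thesis
    using differential_F[OF assms(1) p(2,3) assms(2) tangent_X] p assms by simp
qed

text \<open>Pairing gradients with the component \<open>v c\<close> reproduces the differentials on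
  \<open>v\<close>, so a linear relation between gradients is one between differentials.\<close>

lemma lin_indep_grad:
  assumes "c \<in> A" "x \<in> loc c"
  shows "lin_indep n (\<lambda>i. grad c i x)"
  unfolding lin_indep_def
proof (intro allI impI)
  fix a :: "nat \<Rightarrow> real" and i
  assume sum: "(\<Sum>i<n. a i *\<^sub>R grad c i x) = 0" and "i < n"
  obtain p where p: "x = chart_map c p" "p \<in> chart_dom c" "p \<in> U"
    using assms(2) by (auto simp: loc_def)
  have "(\<Sum>i<n. a i *\<^sub>R differential A (F i) p) v = 0" for v
  proof (cases "v \<in> tangent_space A p")
    case True
    have "(\<Sum>i<n. a i *\<^sub>R differential A (F i) p) v = (\<Sum>i<n. a i *\<^sub>R grad c i x) \<bullet> v c"
      using differential_F[OF assms(1) p(2,3) _ True] p assms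
      by (simp add: sum_fun_apply scaleR_fun_apply inner_sum_left grad_inner)
    then show ?thesis by (simp add: sum)
  next
    case False
    \<comment> \<open>Outside the tangent space the relation holds because differentials are 0 there
      by convention.\<close>
    then show ?thesis by (simp add: sum_fun_apply scaleR_fun_apply differential_def)
  qed
  then have "(\<Sum>i<n. a i *\<^sub>R differential A (F i) p) = 0" by (simp add: fun_eq_iff)
  then show "a i = 0"
    using indep p(3) \<open>i < n\<close> unfolding independent_functions_def lin_indep_def by blast
qed

text \<open>The common kernel is the orthogonal complement of m - 1 independent gradients, a line,
  and the nonzero vector \<open>locX c x\<close> lies on it.\<close>

lemma kernel_line:
  assumes "c \<in> A" "x \<in> loc c" "locX c x \<noteq> 0"
    and "\<And>i. i < n \<Longrightarrow> frechet_derivative (locF c i) (at x) w = 0"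
  obtains r where "w = r *\<^sub>R locX c x"
proof -
  have indep: "lin_indep (DIM('e) - 1) (\<lambda>i. grad c i x)"
    using lin_indep_grad[OF assms(1,2)] by (simp only: n)
  have orth: "grad c i x \<bullet> locX c x = 0" "grad c i x \<bullet> w = 0" if "i < DIM('e) - 1" for i
    using that[folded n] assms locF_locX by (simp_all add: grad_inner)
  show ?thesis
    by (rule orthogonal_line[OF indep orth(1) assms(3) orth(2)]) (assumption | rule that)+
qed

section \<open>Fields dual to the differentials of the integrals\<close>

definition dual_frame :: "('a, 'e) chart \<Rightarrow> (nat \<Rightarrow> 'e \<Rightarrow> 'e) \<Rightarrow> bool" where
  "dual_frame c Z \<longleftrightarrow> (\<forall>i<n. smooth_on (loc c) (Z i)) \<and> (\<forall>x\<in>loc c. \<forall>i<n. \<forall>j<n.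
     frechet_derivative (locF c j) (at x) (Z i x) = (if j = i then 1 else 0))"

lemma dual_frame_smooth: "dual_frame c Z \<Longrightarrow> i < n \<Longrightarrow> smooth_on (loc c) (Z i)"
  unfolding dual_frame_def by blast

lemma dual_frame_dual:
  "dual_frame c Z \<Longrightarrow> x \<in> loc c \<Longrightarrow> i < n \<Longrightarrow> j < n
    \<Longrightarrow> frechet_derivative (locF c j) (at x) (Z i x) = (if j = i then 1 else 0)"
  by (simp add: dual_frame_def)

lemma dual_frame_exists:
  assumes "c \<in> A"
  shows "\<exists>Z. dual_frame c Z"
proof -
  have "smooth_on (loc c) (grad c i)" if "i < n" for i
    unfolding grad_def[abs_def] using assms that
    by (intro smooth_on_sum smooth_on_scaleR smooth_on_const smooth_on_frechet_derivative
        smooth_locF open_loc)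
  from smooth_dual_frame[OF open_loc[OF assms] this lin_indep_grad[OF assms]]
  obtain Z where "(\<forall>i<n. smooth_on (loc c) (Z i)) \<and>
    (\<forall>x\<in>loc c. \<forall>i<n. Z i x \<in> span ((\<lambda>i. grad c i x) ` {..<n}) \<and>
      (\<forall>j<n. grad c j x \<bullet> Z i x = (if j = i then 1 else 0)))" ..
  then have "dual_frame c Z"
    using assms by (simp add: dual_frame_def grad_inner)
  then show ?thesis by (intro exI[of _ Z])
qed

text \<open>Two choices of this vector differ by an element of the kernel of all \<open>dF\<^sub>j\<close>, a line containing
  \<open>X\<close>; so its wedge product with \<open>X\<close> does not depend on the choice, and is therefore smooth even
  though the chosen vectors need not depend continuously on the point.\<close>

definition transversal :: "nat \<Rightarrow> 'a \<Rightarrow> ('a, 'e) chart \<Rightarrow> 'e" where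
  "transversal i p = (SOME v. v \<in> tangent_space A p \<and>
     (\<forall>j<n. differential A (F j) p v = (if j = i then 1 else 0)))"

text \<open>This is Z \<and> X with Z the transversal vector; in this order the contraction with
  dF_i is X and not -X.\<close>

definition biv :: "nat \<Rightarrow> 'a \<Rightarrow> ('a, 'e) bivector" where
  "biv i p \<alpha> \<beta> = (if \<alpha> \<in> cotangent_space A p \<and> \<beta> \<in> cotangent_space A p
     then \<alpha> (transversal i p) * \<beta> (X p) - \<alpha> (X p) * \<beta> (transversal i p) else 0)"

text \<open>A witness for the choice is the lift of a dual frame vector from any one chart around
  \<open>p\<close>.\<close>

lemma transversal:
  assumes "p \<in> U" "i < n"
  shows "transversal i p \<in> tangent_space A p"
    and "\<And>j. j < n \<Longrightarrow> differential A (F j) p (transversal i p) = (if j = i then 1 else 0)"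
proof -
  obtain c where c: "c \<in> A" "p \<in> chart_dom c"
    using assms(1) U(2) by (auto simp: manifold_carrier_def)
  have x: "chart_map c p \<in> loc c" using c assms(1) by (auto simp: loc_def)
  obtain Z where Z: "dual_frame c Z"
    using dual_frame_exists[OF c(1)] ..
  obtain v where v: "v \<in> tangent_space A p" "v c = Z i (chart_map c p)"
    using tangent_space_lift[OF c] by blast
  have "\<forall>j<n. differential A (F j) p v = (if j = i then 1 else 0)"
    using differential_F[OF c assms(1) _ v(1)] v(2) dual_frame_dual[OF Z x assms(2)] by simp
  then have "transversal i p \<in> tangent_space A p \<and>
     (\<forall>j<n. differential A (F j) p (transversal i p) = (if j = i then 1 else 0))"
    unfolding transversal_def using v(1) by (intro someI[of "\<lambda>v. v \<in> tangent_space A p \<and>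
      (\<forall>j<n. differential A (F j) p v = (if j = i then 1 else 0))" v] conjI)
  then show "transversal i p \<in> tangent_space A p"
    "\<And>j. j < n \<Longrightarrow> differential A (F j) p (transversal i p) = (if j = i then 1 else 0)"
    by simp_all
qed

section \<open>Pointwise properties of the bivector fields\<close>

lemma F_cotangent:
  assumes "p \<in> U" "i < n"
  shows "differential A (F i) p \<in> cotangent_space A p"
proof -
  obtain c where c: "c \<in> A" "p \<in> chart_dom c"
    using assms(1) U(2) by (auto simp: manifold_carrier_def)
  show ?thesis
    using c smooth_fun_differentiable[OF smooth_F[OF assms(2)] c assms(1)] by (rule differential_cotangent)
qed

lemma differential_F_X: "p \<in> U \<Longrightarrow> i < n \<Longrightarrow> differential A (F i) p (X p) = 0"
  using integrals U by (auto simp: first_integral_def)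

lemma biv_bivector: "p \<in> U \<Longrightarrow> i < n \<Longrightarrow> biv i p \<in> bivector_space A p"
  unfolding bivector_space_def biv_def
  by (auto simp: cotangent_space_def scaleR_fun_apply algebra_simps)

lemma sharp_biv:
  assumes "p \<in> U" "i < n" "\<alpha> \<in> cotangent_space A p"
  shows "sharp A p (biv i p) \<alpha> = \<alpha> (transversal i p) *\<^sub>R X p - \<alpha> (X p) *\<^sub>R transversal i p"
  using assms U(2) transversal(1)[OF assms(1,2)] tangent_X[OF assms(1)]
  by (intro sharp_eqI) (auto simp: tangent_space_diff tangent_space_scale cotangent_diff
      cotangent_scale biv_def)

lemma rank_biv:
  assumes "p \<in> U" "i < n"
  shows "bivector_rank A p (biv i p) \<le> 2"
proof -
  have "sharp A p (biv i p) ` cotangent_space A p \<subseteq> span {X p, transversal i p}"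
  proof (intro image_subsetI)
    fix \<alpha> assume \<alpha>: "\<alpha> \<in> cotangent_space A p"
    show "sharp A p (biv i p) \<alpha> \<in> span {X p, transversal i p}"
      unfolding sharp_biv[OF assms \<alpha>] by (intro span_diff span_scale span_base) simp_all
  qed
  then have "bivector_rank A p (biv i p) \<le> card {X p, transversal i p}"
    unfolding bivector_rank_def by (intro dim_le_card) auto
  also have "\<dots> \<le> 2" by (simp add: card_insert_if)
  finally show ?thesis .
qed

text \<open>The Hamiltonian function is \<open>F i\<close>: its differential is 1 on the transversal
  vector and 0 on \<open>X\<close>, so \<open>sharp_biv\<close> leaves only
  \<open>X p\<close>.\<close>

lemma hamiltonian_biv:
  assumes "i < n"
  shows "hamiltonian A U (biv i) X"
  unfolding hamiltonian_def
proof (intro exI conjI ballI)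
  show "smooth_fun A U (F i)" using assms by (rule smooth_F)
  fix p assume "p \<in> U"
  then show "X p = sharp A p (biv i p) (differential A (F i) p)"
    using assms by (simp add: sharp_biv F_cotangent transversal differential_F_X)
qed

text \<open>Evaluate a relation on dF_j and a covector \<beta>: \<open>biv i p\<close> gives
  \<beta>(X) for i = j and 0 otherwise, which isolates the coefficient \<open>a j\<close>.\<close>

lemma lin_indep_biv:
  assumes "p \<in> U" "X p \<noteq> 0"
  shows "lin_indep n (\<lambda>i. biv i p)"
  unfolding lin_indep_def
proof (intro allI impI)
  fix a :: "nat \<Rightarrow> real" and j
  assume sum: "(\<Sum>i<n. a i *\<^sub>R biv i p) = 0" and "j < n"
  \<comment> \<open>Such a covector exists because \<open>X p\<close> is nonzero and covectors
    separate tangent vectors.\<close>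
  obtain \<beta> where \<beta>: "\<beta> \<in> cotangent_space A p" "\<beta> (X p) \<noteq> \<beta> 0"
    using cotangent_separates[of p "X p" 0] assms U tangent_X subspace_0[OF subspace_tangent_space]
    by blast
  have "\<beta> 0 = 0"
    using cotangent_scale[OF \<beta>(1) tangent_X[OF assms(1)], of 0] by simp
  have "0 = (\<Sum>i<n. a i *\<^sub>R biv i p) (differential A (F j) p) \<beta>"
    by (simp add: sum)
  also have "\<dots> = (\<Sum>i<n. if i = j then a i * \<beta> (X p) else 0)"
    unfolding sum_fun_apply scaleR_fun_apply using \<open>j < n\<close> assms \<beta>(1)
    by (intro sum.cong) (auto simp: biv_def F_cotangent transversal differential_F_X)
  also have "\<dots> = a j * \<beta> (X p)"
    using \<open>j < n\<close> by simp
  finally show "a j = 0" using \<beta>(2) \<open>\<beta> 0 = 0\<close> by simp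
qed

text \<open>The transversal vector may be replaced by any \<open>Y\<close> with the same pairings at
  the point: their difference is a multiple of X, which the wedge with X kills, and where X vanishes
  both sides are 0. Thus a smooth frame can stand in for the pointwise choice.\<close>

lemma biv_chart:
  assumes c: "c \<in> A" "p \<in> chart_dom c" "p \<in> U" and i: "i < n"
    and f: "(f \<circ> chart_inv c) differentiable (at (chart_map c p))"
    and g: "(g \<circ> chart_inv c) differentiable (at (chart_map c p))"
    and Y: "\<And>j. j < n \<Longrightarrow>
      frechet_derivative (locF c j) (at (chart_map c p)) (Y (chart_map c p)) = (if j = i then 1 else 0)"
  shows "biv i p (differential A f p) (differential A g p)
    = wedge Y (locX c) (f \<circ> chart_inv c) (g \<circ> chart_inv c) (chart_map c p)"
proof -
  let ?x = "chart_map c p"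
  let ?Df = "frechet_derivative (f \<circ> chart_inv c) (at ?x)"
  let ?Dg = "frechet_derivative (g \<circ> chart_inv c) (at ?x)"
  have x: "?x \<in> loc c" using c by (auto simp: loc_def)
  note T = transversal[OF c(3) i]
  have lin: "linear ?Df" "linear ?Dg" using f g by (auto intro: linear_frechet_derivative)
  have biv: "biv i p (differential A f p) (differential A g p)
      = ?Df (transversal i p c) * ?Dg (X p c) - ?Df (X p c) * ?Dg (transversal i p c)"
    using differential_cotangent[OF c(1,2) f] differential_cotangent[OF c(1,2) g]
      differential_chart[OF c(1,2) f] differential_chart[OF c(1,2) g] T(1) tangent_X[OF c(3)]
    by (simp add: biv_def)
  show ?thesis
  proof (cases "X p c = 0")
    case True
    then show ?thesis
      using c by (simp add: biv wedge_def lie_def linear_0[OF lin(1)] linear_0[OF lin(2)])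
  next
    case False
    \<comment> \<open>Both vectors have the same pairing with every dF_j, so their difference lies
      in the common kernel.\<close>
    have "frechet_derivative (locF c j) (at ?x) (transversal i p c - Y ?x) = 0" if "j < n" for j
      using differential_F[OF c that T(1)] T(2)[OF that] Y[OF that]
        linear_frechet_derivative[OF smooth_on_differentiable[OF smooth_locF[OF c(1) that] x]]
      by (simp add: linear_diff)
    from kernel_line[OF c(1) x _ this] obtain r where "transversal i p c - Y ?x = r *\<^sub>R X p c"
      using False c by auto
    then have "transversal i p c = Y ?x + r *\<^sub>R X p c" by (simp add: algebra_simps)
    then show ?thesis
      using c by (simp add: biv wedge_def lie_def linear_add[OF lin(1)] linear_add[OF lin(2)]
          linear_cmul[OF lin(1)] linear_cmul[OF lin(2)] algebra_simps)
  qed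
qed

section \<open>Smoothness of the bivector fields\<close>

lemma coordinate_frechet_derivative:
  assumes "c \<in> A" "p \<in> chart_dom c"
  shows "(\<lambda>q. chart_map c q \<bullet> b) \<circ> chart_inv c differentiable (at (chart_map c p))"
    and "frechet_derivative ((\<lambda>q. chart_map c q \<bullet> b) \<circ> chart_inv c) (at (chart_map c p)) = (\<lambda>v. v \<bullet> b)"
proof -
  have "((\<lambda>x. x \<bullet> b) has_derivative (\<lambda>v. v \<bullet> b)) (at (chart_map c p))"
    by (auto intro!: derivative_eq_intros)
  then have *: "((\<lambda>q. chart_map c q \<bullet> b) \<circ> chart_inv c has_derivative (\<lambda>v. v \<bullet> b)) (at (chart_map c p))"
    by (rule has_derivative_transform_within_open[OF _ open_overlap[of c c]]) (use assms in auto)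
  show "(\<lambda>q. chart_map c q \<bullet> b) \<circ> chart_inv c differentiable (at (chart_map c p))"
    using * differentiable_def by blast
  show "frechet_derivative ((\<lambda>q. chart_map c q \<bullet> b) \<circ> chart_inv c) (at (chart_map c p)) = (\<lambda>v. v \<bullet> b)"
    using frechet_derivative_at[OF *] by simp
qed

lemma smooth_biv:
  assumes "i < n"
  shows "smooth_bivector_field A U (biv i)"
  unfolding smooth_bivector_field_def
proof (intro conjI ballI)
  show "biv i p \<in> bivector_space A p" if "p \<in> U" for p
    using that assms by (rule biv_bivector)
  fix c and k l :: 'e
  assume c: "c \<in> A"
  obtain Z where Z: "dual_frame c Z"
    using dual_frame_exists[OF c] ..
  \<comment> \<open>These are the components of Z \<and> X for a smooth dual frame; by
    \<open>biv_chart\<close> they are the components of \<open>biv i\<close>.\<close>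
  have "smooth_on (loc c) (\<lambda>x. (Z i x \<bullet> k) * (locX c x \<bullet> l) - (locX c x \<bullet> k) * (Z i x \<bullet> l))"
    using dual_frame_smooth[OF Z assms] smooth_locX[OF c] open_loc[OF c]
    by (intro smooth_on_diff smooth_on_mult smooth_on_inner smooth_on_const)
  then have "smooth_on (loc c)
      ((\<lambda>p. biv i p (differential A (\<lambda>q. chart_map c q \<bullet> k) p)
                  (differential A (\<lambda>q. chart_map c q \<bullet> l) p)) \<circ> chart_inv c)"
  proof (rule smooth_on_cong[OF open_loc[OF c]])
    fix x assume x: "x \<in> loc c"
    then obtain p where p: "x = chart_map c p" "p \<in> chart_dom c" "p \<in> U" by (auto simp: loc_def)
    have "biv i p (differential A (\<lambda>q. chart_map c q \<bullet> k) p) (differential A (\<lambda>q. chart_map c q \<bullet> l) p)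
      = wedge (Z i) (locX c) ((\<lambda>q. chart_map c q \<bullet> k) \<circ> chart_inv c)
          ((\<lambda>q. chart_map c q \<bullet> l) \<circ> chart_inv c) x"
      unfolding p(1) using c p assms dual_frame_dual[OF Z] x
      by (intro biv_chart coordinate_frechet_derivative) auto
    then show "(Z i x \<bullet> k) * (locX c x \<bullet> l) - (locX c x \<bullet> k) * (Z i x \<bullet> l) =
      ((\<lambda>p. biv i p (differential A (\<lambda>q. chart_map c q \<bullet> k) p)
                  (differential A (\<lambda>q. chart_map c q \<bullet> l) p)) \<circ> chart_inv c) x"
      using c p by (simp add: wedge_def lie_def coordinate_frechet_derivative)
  qed
  then show "smooth_on (chart_map c ` (chart_dom c \<inter> U))
      ((\<lambda>p. biv i p (differential A (\<lambda>q. chart_map c q \<bullet> k) p)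
                  (differential A (\<lambda>q. chart_map c q \<bullet> l) p)) \<circ> chart_inv c)"
    by (simp add: loc_def)
qed

text \<open>Both \<open>Z(F\<^sub>j)\<close> and \<open>X(F\<^sub>j)\<close> are constant, so \<open>[Z, X](F\<^sub>j) = 0\<close>.\<close>

lemma bracket_parallel:
  assumes c: "c \<in> A" "x \<in> loc c" and Z: "smooth_on (loc c) Z"
    and dual: "\<And>y j. y \<in> loc c \<Longrightarrow> j < n \<Longrightarrow> frechet_derivative (locF c j) (at y) (Z y) = k j"
  obtains r where "lie_bracket Z (locX c) x = r *\<^sub>R locX c x \<or> locX c x = 0"
proof (cases "locX c x = 0")
  case False
  have "frechet_derivative (locF c j) (at x) (lie_bracket Z (locX c) x) = 0" if "j < n" for j
  proof -
    \<comment> \<open>A function constant on the open set \<open>loc c\<close> has zero derivative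
      along every field; it is applied to the constants 0 and \<open>k j\<close>.\<close>
    have const: "lie Y u x = 0" if "\<And>y. y \<in> loc c \<Longrightarrow> u y = a" for Y u a
    proof -
      have "frechet_derivative (\<lambda>y. a) (at x) = frechet_derivative u (at x)"
        using that open_loc[OF c(1)] c(2) by (intro frechet_derivative_transform_within_open) auto
      from fun_cong[OF this, of "Y x"] show ?thesis by (simp add: lie_def)
    qed
    have "lie Z (lie (locX c) (locF c j)) x = 0"
      by (rule const) (use locF_locX c that in \<open>auto simp: lie_def\<close>)
    moreover have "lie (locX c) (lie Z (locF c j)) x = 0"
      by (rule const) (use dual that in \<open>auto simp: lie_def\<close>)
    ultimately show ?thesis
      using lie_commutator[OF open_loc[OF c(1)] Z smooth_locX[OF c(1)] smooth_locF[OF c(1) that] c(2)]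
      by simp
  qed
  from kernel_line[OF c False this] show ?thesis using that by blast
qed (use that in blast)

text \<open>One dual frame in a chart represents both fields, which reduces the bracket at
  \<open>p\<close> to \<open>schouten_wedge\<close>. The case i = j is the Poisson
  condition.\<close>

lemma commuting_biv:
  assumes ij: "i < n" "j < n"
  shows "commuting A U (biv i) (biv j)"
  unfolding commuting_def
proof (intro allI impI ballI)
  fix V f g h p
  assume "open V \<and> V \<subseteq> U \<and> smooth_fun A V f \<and> smooth_fun A V g \<and> smooth_fun A V h" and p: "p \<in> V"
  then have V: "open V" "V \<subseteq> U" and smooth: "smooth_fun A V f" "smooth_fun A V g" "smooth_fun A V h"
    by auto
  obtain c where c: "c \<in> A" "p \<in> chart_dom c"
    using p V U by (auto simp: manifold_carrier_def)
  define S where "S = chart_map c ` (chart_dom c \<inter> V)"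
  define x where "x = chart_map c p"
  have S: "open S" "S \<subseteq> loc c" "x \<in> S"
    using open_image[OF c(1) V(1)] V(2) c p by (auto simp: S_def x_def loc_def)
  obtain Z where Z: "dual_frame c Z"
    using dual_frame_exists[OF c(1)] ..
  have ZS: "smooth_on S (Z i)" if "i < n" for i
    using dual_frame_smooth[OF Z that] S(2) by (rule smooth_on_subset)
  have XS: "smooth_on S (locX c)"
    using smooth_locX[OF c(1)] S(2) by (rule smooth_on_subset)
  have loc_smooth: "smooth_on S (u \<circ> chart_inv c)" if "smooth_fun A V u" for u
    using that c by (simp add: smooth_fun_def S_def)
  have apply1: "bivector_apply A (biv i) u v q = wedge (Z i) (locX c) (u \<circ> chart_inv c) (v \<circ> chart_inv c) (chart_map c q)"
    if "i < n" "smooth_on S (u \<circ> chart_inv c)" "smooth_on S (v \<circ> chart_inv c)" "q \<in> chart_dom c" "q \<in> V" for i u v q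
    unfolding bivector_apply_def using that c V dual_frame_dual[OF Z] S
    by (intro biv_chart smooth_on_differentiable[of S]) (auto simp: S_def)
  \<comment> \<open>The outer bracket differentiates the inner one, so the inner one must equal its
    coordinate expression on all of \<open>S\<close> and not just at \<open>x\<close>.\<close>
  have apply2: "bivector_apply A (biv i) (bivector_apply A (biv j) u v) w p
    = wedge (Z i) (locX c) (wedge (Z j) (locX c) (u \<circ> chart_inv c) (v \<circ> chart_inv c)) (w \<circ> chart_inv c) x"
    if "i < n" "j < n" "smooth_fun A V u" "smooth_fun A V v" "smooth_fun A V w" for i j u v w
  proof -
    let ?u = "u \<circ> chart_inv c" and ?v = "v \<circ> chart_inv c"
    let ?G = "bivector_apply A (biv j) u v \<circ> chart_inv c"
    have eq: "wedge (Z j) (locX c) ?u ?v y = ?G y" if "y \<in> S" for y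
      using that apply1[OF \<open>j < n\<close> loc_smooth loc_smooth, of u v] \<open>smooth_fun A V u\<close> \<open>smooth_fun A V v\<close> c
      by (auto simp: S_def)
    have wS: "smooth_on S (wedge (Z j) (locX c) ?u ?v)"
      using that by (intro smooth_on_wedge S ZS XS loc_smooth)
    then have "smooth_on S ?G"
      by (rule smooth_on_cong[OF S(1)]) (rule eq)
    \<comment> \<open>The outer \<open>wedge\<close> sees the inner function only through its
      derivative at \<open>x\<close>.\<close>
    moreover have "frechet_derivative (wedge (Z j) (locX c) ?u ?v) (at x) = frechet_derivative ?G (at x)"
      using smooth_on_differentiable[OF wS] S eq by (intro frechet_derivative_transform_within_open) auto
    ultimately show ?thesis
      using apply1[OF \<open>i < n\<close> _ loc_smooth[OF that(5)] c(2) p, of "bivector_apply A (biv j) u v"]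
      by (simp add: wedge_def[of _ _ ?G] wedge_def[of _ _ "wedge _ _ _ _"] lie_def x_def)
  qed
  obtain a where a: "lie_bracket (Z i) (locX c) x = a *\<^sub>R locX c x \<or> locX c x = 0"
    using bracket_parallel[OF c(1) _ dual_frame_smooth[OF Z ij(1)] dual_frame_dual[OF Z _ ij(1)]] S by blast
  obtain b where b: "lie_bracket (Z j) (locX c) x = b *\<^sub>R locX c x \<or> locX c x = 0"
    using bracket_parallel[OF c(1) _ dual_frame_smooth[OF Z ij(2)] dual_frame_dual[OF Z _ ij(2)]] S by blast
  show "schouten A (biv i) (biv j) f g h p = 0"
    using schouten_wedge[OF S(1,3) ZS[OF ij(1)] ZS[OF ij(2)] XS loc_smooth[OF smooth(1)]
        loc_smooth[OF smooth(2)] loc_smooth[OF smooth(3)] a b]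
    by (simp add: schouten_def apply2 ij smooth)
qed

end

text \<open>The last conjunct rules out degenerate families such as one structure repeated. It is
  restricted to \<open>X p \<noteq> 0\<close> because the constructed bivectors vanish wherever X
  does.\<close>

theorem proposition3p4:
  fixes A :: "('a::{second_countable_topology, t2_space}, 'e::euclidean_space) chart set"
    and X :: "'a \<Rightarrow> ('a, 'e) chart \<Rightarrow> 'e"
    and F :: "nat \<Rightarrow> 'a \<Rightarrow> real"
    and U :: "'a set"
    and m :: nat
  assumes "smooth_manifold A"
    and "m = DIM('e)"
    and "smooth_vector_field A (manifold_carrier A) X"
    and "open U" and "U \<subseteq> manifold_carrier A" and "manifold_carrier A \<subseteq> closure U"
    and "\<forall>i < m - 1. first_integral A X (F i)"
    and "independent_functions A U (m - 1) F"
  shows "\<exists>\<pi> :: nat \<Rightarrow> 'a \<Rightarrow> ('a, 'e) bivector.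
           (\<forall>i < m - 1. poisson_structure A U (\<pi> i) \<and>
                        (\<forall>p\<in>U. bivector_rank A p (\<pi> i p) \<le> 2) \<and>
                        hamiltonian A U (\<pi> i) X) \<and>
           (\<forall>i < m - 1. \<forall>j < m - 1. commuting A U (\<pi> i) (\<pi> j)) \<and>
           (\<forall>p\<in>U. X p \<noteq> 0 \<longrightarrow> lin_indep (m - 1) (\<lambda>i. \<pi> i p))"
proof -
  interpret integrable_field A X F U "m - 1"
    by unfold_locales (use assms in auto)
  show ?thesis
    by (intro exI[of _ biv])
       (auto simp: poisson_structure_def smooth_biv commuting_biv rank_biv hamiltonian_biv lin_indep_biv
         simp del: One_nat_def)
qed

end
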